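(* Let $(B_t)_{t\ge0}$ be the canonical $1$-dimensional $G$-Brownian motion on $\Omega=C([0,\infty);\mathbb R)$ with $\underline\sigma^2:=-\hat{\mathbb E}[-B_1^2]>0$, and let $a\in\mathbb R$. For $\omega\in\Omega$ put $\mathcal L_\omega(a):=\{t\ge0:B_t(\omega)=a\}$. Then for quasi-surely every $\omega\in\Omega$, the level set $\mathcal L_\omega(a)$ has no isolated point in $[0,\infty)$.
   Context: $C_{b.Lip}(\mathbb{R}^k)$: bounded Lipschitz functions. A sublinear expectation space is a triple (set, $\mathcal H$, $\tilde{\mathbb E}$) with $\mathcal H$ a linear space of real functions on the set closed under composition with $C_{b.Lip}$ functions of finitely many elements, and $\tilde{\mathbb E}:\mathcal H\to\mathbb R$ monotone, constant preserving, sub-additive and positively homogeneous. $X_1\overset{d}{=}X_2$ means equality of the (sublinear) expectations of $\varphi(X_1)$ and $\varphi(X_2)$ for all $\varphi\in C_{b.Lip}$; $Y$ is independent from $X$ if $\tilde{\mathbb E}[\varphi(X,Y)]=\tilde{\mathbb E}[\tilde{\mathbb E}[\varphi(x,Y)]_{x=X}]$ for all $\varphi\in C_{b.Lip}$. A random variable $X$ is $G$-normally distributed if $aX+b\bar X\overset{d}{=}\sqrt{a^2+b^2}X$ for all $a,b\ge0$, where $\bar X\overset{d}{=}X$ is independent from $X$, and $G(\alpha)=\frac12\tilde{\mathbb E}[\alpha X^2]$ for $\alpha\in\mathbb R$. Fix a monotone sublinear $G:\mathbb R\to\mathbb R$. $\Omega=C([0,\infty);\mathbb R)$ carries the topology of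 locally uniform convergence, $B_t(\omega)=\omega_t$, $\mathcal F=\sigma(B_s:s\ge0)$. $L_{ip}(\Omega)$ is the set of $X=\varphi(B_{t_1},B_{t_2}-B_{t_1},\dots,B_{t_n}-B_{t_{n-1}})$, $\varphi\in C_{b.Lip}$, $0\le t_1<\dots<t_n<\infty$, and $\hat{\mathbb E}[X]:=\tilde{\mathbb E}[\varphi(\sqrt{t_1}\xi_1,\dots,\sqrt{t_n-t_{n-1}}\xi_n)]$ with $\xi_i$ identically distributed, $G$-normal, $\xi_{i+1}$ independent from $(\xi_1,\dots,\xi_i)$; under $\hat{\mathbb E}$, $B$ is a $G$-Brownian motion. $L^1_G(\Omega)$ is the completion of $L_{ip}(\Omega)$ under $\hat{\mathbb E}[|\cdot|]$. There is a weakly compact family $\mathcal P$ of probability measures on $(\Omega,\mathcal F)$ with $\hat{\mathbb E}[X]=\sup_{P\in\mathcal P}E_P[X]$ for $X\in L^1_G(\Omega)$. Put $c(A)=\sup_{P\in\mathcal P}P(A)$ for $A\in\mathcal F$. A set $A\in\mathcal F$ is polar if $c(A)=0$; a property holds quasi-surely (q.s.) if it holds outside a polar set. *)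

theory Defs
  imports "HOL-Probability.Probability"
begin

section \<open>Sublinear expectation spaces\<close>

text \<open>A function on \<open>k\<close>-dimensional space is a function on real lists, of which only the values on
  lists of length \<open>k\<close> matter.  Random vectors are lists of random variables.\<close>

definition CbLip :: "nat \<Rightarrow> (real list \<Rightarrow> real) \<Rightarrow> bool" where
  "CbLip k \<phi> \<longleftrightarrow>
     (\<exists>C. \<forall>x. length x = k \<longrightarrow> \<bar>\<phi> x\<bar> \<le> C) \<and>
     (\<exists>L. \<forall>x y. length x = k \<longrightarrow> length y = k \<longrightarrow>
        \<bar>\<phi> x - \<phi> y\<bar> \<le> L * L2_set (\<lambda>i. x ! i - y ! i) {..<k})"

definition eval_vec :: "('w \<Rightarrow> real) list \<Rightarrow> 'w \<Rightarrow> real list" where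
  "eval_vec Xs w = map (\<lambda>X. X w) Xs"

locale sublinear_expectation_space =
  fixes H :: "('w \<Rightarrow> real) set" and E :: "('w \<Rightarrow> real) \<Rightarrow> real"
  assumes zero_mem: "(\<lambda>_. 0) \<in> H"
    and add_mem: "X \<in> H \<Longrightarrow> Y \<in> H \<Longrightarrow> (\<lambda>w. X w + Y w) \<in> H"
    and scale_mem: "X \<in> H \<Longrightarrow> (\<lambda>w. r * X w) \<in> H"
    and comp_mem: "set Xs \<subseteq> H \<Longrightarrow> CbLip (length Xs) \<phi> \<Longrightarrow> (\<lambda>w. \<phi> (eval_vec Xs w)) \<in> H"
    and monotone: "X \<in> H \<Longrightarrow> Y \<in> H \<Longrightarrow> (\<And>w. X w \<le> Y w) \<Longrightarrow> E X \<le> E Y"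
    and constant_preserving: "E (\<lambda>_. r) = r"
    and subadditive: "X \<in> H \<Longrightarrow> Y \<in> H \<Longrightarrow> E (\<lambda>w. X w + Y w) \<le> E X + E Y"
    and pos_homogeneous: "X \<in> H \<Longrightarrow> 0 \<le> r \<Longrightarrow> E (\<lambda>w. r * X w) = r * E X"

definition eq_in_dist :: "(('w \<Rightarrow> real) \<Rightarrow> real) \<Rightarrow> ('w \<Rightarrow> real) \<Rightarrow> ('w \<Rightarrow> real) \<Rightarrow> bool" where
  "eq_in_dist E X Y \<longleftrightarrow> (\<forall>\<phi>. CbLip 1 \<phi> \<longrightarrow> E (\<lambda>w. \<phi> [X w]) = E (\<lambda>w. \<phi> [Y w]))"

text \<open>\<open>indep_from E Y Xs\<close>: the random variable \<open>Y\<close> is independent from the random vector \<open>Xs\<close>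
  (this relation is not symmetric for sublinear expectations).\<close>

definition indep_from :: "(('w \<Rightarrow> real) \<Rightarrow> real) \<Rightarrow> ('w \<Rightarrow> real) \<Rightarrow> ('w \<Rightarrow> real) list \<Rightarrow> bool" where
  "indep_from E Y Xs \<longleftrightarrow>
     (\<forall>\<phi>. CbLip (Suc (length Xs)) \<phi> \<longrightarrow>
        E (\<lambda>w. \<phi> (eval_vec Xs w @ [Y w])) =
        E (\<lambda>w. E (\<lambda>w'. \<phi> (eval_vec Xs w @ [Y w']))))"

text \<open>Square integrability is required for \<open>G\<close> to be meaningful.\<close>

definition G_normal ::
  "('w \<Rightarrow> real) set \<Rightarrow> (('w \<Rightarrow> real) \<Rightarrow> real) \<Rightarrow> (real \<Rightarrow> real) \<Rightarrow> ('w \<Rightarrow> real) \<Rightarrow> bool" where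
  "G_normal H E G X \<longleftrightarrow>
     X \<in> H \<and> (\<lambda>w. (X w)\<^sup>2) \<in> H \<and>
     (\<exists>X'\<in>H. eq_in_dist E X' X \<and> indep_from E X' [X] \<and>
        (\<forall>a\<ge>0. \<forall>b\<ge>0. eq_in_dist E (\<lambda>w. a * X w + b * X' w) (\<lambda>w. sqrt (a\<^sup>2 + b\<^sup>2) * X w))) \<and>
     (\<forall>\<alpha>. G \<alpha> = 1/2 * E (\<lambda>w. \<alpha> * (X w)\<^sup>2))"

definition monotone_sublinear :: "(real \<Rightarrow> real) \<Rightarrow> bool" where
  "monotone_sublinear G \<longleftrightarrow>
     mono G \<and> (\<forall>x y. G (x + y) \<le> G x + G y) \<and> (\<forall>r\<ge>0. \<forall>x. G (r * x) = r * G x)"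

section \<open>The canonical path space\<close>

definition paths :: "(real \<Rightarrow> real) set" where
  "paths = {\<omega> \<in> extensional {0..}. continuous_on {0..} \<omega>}"

definition B :: "real \<Rightarrow> (real \<Rightarrow> real) \<Rightarrow> real" where
  "B t \<omega> = \<omega> t"

text \<open>The topology of locally uniform convergence.\<close>

definition path_open :: "(real \<Rightarrow> real) set \<Rightarrow> bool" where
  "path_open U \<longleftrightarrow> U \<subseteq> paths \<and>
     (\<forall>\<omega>\<in>U. \<exists>T\<ge>0. \<exists>\<epsilon>>0. \<forall>\<omega>'\<in>paths. (\<forall>t\<in>{0..T}. \<bar>\<omega>' t - \<omega> t\<bar> < \<epsilon>) \<longrightarrow> \<omega>' \<in> U)"

definition path_topology :: "(real \<Rightarrow> real) topology" where
  "path_topology = topology path_open"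

lemma istopology_path_open: "istopology path_open"
  unfolding istopology_def
proof (intro conjI allI impI)
  fix S U assume S: "path_open S" and U: "path_open U"
  show "path_open (S \<inter> U)"
    unfolding path_open_def
  proof (intro conjI ballI)
    show "S \<inter> U \<subseteq> paths" using S unfolding path_open_def by blast
    fix \<omega> assume \<omega>: "\<omega> \<in> S \<inter> U"
    from S \<omega> have "\<exists>T\<ge>0. \<exists>\<epsilon>>0. \<forall>\<omega>'\<in>paths. (\<forall>t\<in>{0..T}. \<bar>\<omega>' t - \<omega> t\<bar> < \<epsilon>) \<longrightarrow> \<omega>' \<in> S"
      unfolding path_open_def by blast
    then obtain T1 e1 where 1: "T1 \<ge> 0" "e1 > 0"
      "\<forall>\<omega>'\<in>paths. (\<forall>t\<in>{0..T1}. \<bar>\<omega>' t - \<omega> t\<bar> < e1) \<longrightarrow> \<omega>' \<in> S" by blast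
    from U \<omega> have "\<exists>T\<ge>0. \<exists>\<epsilon>>0. \<forall>\<omega>'\<in>paths. (\<forall>t\<in>{0..T}. \<bar>\<omega>' t - \<omega> t\<bar> < \<epsilon>) \<longrightarrow> \<omega>' \<in> U"
      unfolding path_open_def by blast
    then obtain T2 e2 where 2: "T2 \<ge> 0" "e2 > 0"
      "\<forall>\<omega>'\<in>paths. (\<forall>t\<in>{0..T2}. \<bar>\<omega>' t - \<omega> t\<bar> < e2) \<longrightarrow> \<omega>' \<in> U" by blast
    have "\<omega>' \<in> S \<inter> U"
      if "\<omega>' \<in> paths" "\<forall>t\<in>{0..max T1 T2}. \<bar>\<omega>' t - \<omega> t\<bar> < min e1 e2" for \<omega>'
    proof
      have "\<forall>t\<in>{0..T1}. \<bar>\<omega>' t - \<omega> t\<bar> < e1" using that(2) by auto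
      then show "\<omega>' \<in> S" using 1(3) that(1) by blast
      have "\<forall>t\<in>{0..T2}. \<bar>\<omega>' t - \<omega> t\<bar> < e2" using that(2) by auto
      then show "\<omega>' \<in> U" using 2(3) that(1) by blast
    qed
    moreover have "max T1 T2 \<ge> 0" "min e1 e2 > 0" using 1 2 by simp_all
    ultimately show "\<exists>T\<ge>0. \<exists>\<epsilon>>0. \<forall>\<omega>'\<in>paths. (\<forall>t\<in>{0..T}. \<bar>\<omega>' t - \<omega> t\<bar> < \<epsilon>) \<longrightarrow> \<omega>' \<in> S \<inter> U"
      by blast
  qed
next
  fix K assume K: "\<forall>S\<in>K. path_open S"
  show "path_open (\<Union>K)"
    unfolding path_open_def
  proof (intro conjI ballI)
    show "\<Union>K \<subseteq> paths" using K unfolding path_open_def by blast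
    fix \<omega> assume "\<omega> \<in> \<Union>K"
    then obtain S where S: "S \<in> K" "\<omega> \<in> S" by blast
    then have "\<exists>T\<ge>0. \<exists>\<epsilon>>0. \<forall>\<omega>'\<in>paths. (\<forall>t\<in>{0..T}. \<bar>\<omega>' t - \<omega> t\<bar> < \<epsilon>) \<longrightarrow> \<omega>' \<in> S"
      using K unfolding path_open_def by blast
    then show "\<exists>T\<ge>0. \<exists>\<epsilon>>0. \<forall>\<omega>'\<in>paths. (\<forall>t\<in>{0..T}. \<bar>\<omega>' t - \<omega> t\<bar> < \<epsilon>) \<longrightarrow> \<omega>' \<in> \<Union>K"
      using S(1) by (meson UnionI)
  qed
qed

lemma openin_path_topology: "openin path_topology = path_open"
  unfolding path_topology_def by (rule topology_inverse'[OF istopology_path_open])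

lemma topspace_path_topology: "topspace path_topology = paths"
proof
  show "topspace path_topology \<subseteq> paths"
    using openin_topspace[of path_topology] by (auto simp: openin_path_topology path_open_def)
  have "path_open paths" unfolding path_open_def by (meson order_refl subset_refl zero_less_one)
  then show "paths \<subseteq> topspace path_topology"
    by (intro openin_subset) (simp add: openin_path_topology)
qed

definition path_algebra :: "(real \<Rightarrow> real) measure" where
  "path_algebra = sigma paths {{\<omega> \<in> paths. B s \<omega> \<in> A} | s A. 0 \<le> s \<and> A \<in> sets borel}"

definition path_probs :: "(real \<Rightarrow> real) measure set" where
  "path_probs = {P. prob_space P \<and> sets P = sets path_algebra}"

definition weak_topology :: "(real \<Rightarrow> real) measure topology" where
  "weak_topology = topology_generated_by
     {{P \<in> path_probs. (\<integral>\<omega>. f \<omega> \<partial>P) \<in> U} | f U.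
        continuous_map path_topology euclideanreal f \<and> bounded (f ` paths) \<and> open U}"

section \<open>The G-expectation\<close>

text \<open>\<open>diffs [x1, ..., xn] = [x1, x2 - x1, ..., xn - x(n-1)]\<close>\<close>

definition diffs :: "real list \<Rightarrow> real list" where
  "diffs x = map (\<lambda>i. if i = 0 then x ! 0 else x ! i - x ! (i - 1)) [0..<length x]"

definition time_grid :: "real list \<Rightarrow> bool" where
  "time_grid ts \<longleftrightarrow> ts \<noteq> [] \<and> 0 \<le> hd ts \<and> sorted_wrt (<) ts"

definition cylinder_fun :: "(real list \<Rightarrow> real) \<Rightarrow> real list \<Rightarrow> (real \<Rightarrow> real) \<Rightarrow> real" where
  "cylinder_fun \<phi> ts = (\<lambda>\<omega>. \<phi> (diffs (map (\<lambda>t. B t \<omega>) ts)))"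

definition L_ip :: "((real \<Rightarrow> real) \<Rightarrow> real) set" where
  "L_ip = {cylinder_fun \<phi> ts | \<phi> ts. time_grid ts \<and> CbLip (length ts) \<phi>}"

definition G_expectation_on_L_ip ::
  "(('w \<Rightarrow> real) \<Rightarrow> real) \<Rightarrow> (nat \<Rightarrow> 'w \<Rightarrow> real) \<Rightarrow> (((real \<Rightarrow> real) \<Rightarrow> real) \<Rightarrow> real) \<Rightarrow> bool" where
  "G_expectation_on_L_ip E \<xi> Ehat \<longleftrightarrow>
     (\<forall>\<phi> ts. time_grid ts \<longrightarrow> CbLip (length ts) \<phi> \<longrightarrow>
        Ehat (cylinder_fun \<phi> ts) =
        E (\<lambda>w. \<phi> (map (\<lambda>i. sqrt (diffs ts ! i) * \<xi> i w) [0..<length ts])))"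

text \<open>The completion of \<open>L_ip\<close>, realised by measurable functions: if \<open>\<P>\<close> represents the
  G-expectation, then \<open>sup {E_P \<bar>X\<bar> | P \<in> \<P>}\<close> is the norm of the completion on \<open>L_ip\<close>, the
  measurable functions for which it is finite form a complete space (modulo quasi-sure equality), and
  the closure of \<open>L_ip\<close> in that space is taken.  The nonnegative integral with values in
  \<open>ennreal\<close> avoids the convention that non-integrable functions have integral \<open>0\<close>.\<close>

definition L1_G :: "(real \<Rightarrow> real) measure set \<Rightarrow> ((real \<Rightarrow> real) \<Rightarrow> real) set" where
  "L1_G \<P> = {X \<in> borel_measurable path_algebra.
     \<exists>Y. (\<forall>n. Y n \<in> L_ip) \<and>
         (\<lambda>n. SUP P\<in>\<P>. \<integral>\<^sup>+\<omega>. ennreal \<bar>Y n \<omega> - X \<omega>\<bar> \<partial>P) \<longlonglongrightarrow> 0}"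

text \<open>Both \<open>Ehat\<close> on the completion (as the continuous extension) and \<open>\<P>\<close> enter through this property.\<close>

definition represents ::
  "(real \<Rightarrow> real) measure set \<Rightarrow> (((real \<Rightarrow> real) \<Rightarrow> real) \<Rightarrow> real) \<Rightarrow> bool" where
  "represents \<P> Ehat \<longleftrightarrow>
     \<P> \<noteq> {} \<and> \<P> \<subseteq> path_probs \<and> compactin weak_topology \<P> \<and>
     (\<forall>X\<in>L1_G \<P>. Ehat X = (SUP P\<in>\<P>. \<integral>\<omega>. X \<omega> \<partial>P))"

definition capacity :: "(real \<Rightarrow> real) measure set \<Rightarrow> (real \<Rightarrow> real) set \<Rightarrow> real" where
  "capacity \<P> A = (SUP P\<in>\<P>. measure P A)"

definition polar :: "(real \<Rightarrow> real) measure set \<Rightarrow> (real \<Rightarrow> real) set \<Rightarrow> bool" where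
  "polar \<P> A \<longleftrightarrow> A \<in> sets path_algebra \<and> capacity \<P> A = 0"

definition quasi_surely :: "(real \<Rightarrow> real) measure set \<Rightarrow> ((real \<Rightarrow> real) \<Rightarrow> bool) \<Rightarrow> bool" where
  "quasi_surely \<P> Q \<longleftrightarrow> (\<exists>A. polar \<P> A \<and> (\<forall>\<omega> \<in> paths - A. Q \<omega>))"

definition level_set :: "real \<Rightarrow> (real \<Rightarrow> real) \<Rightarrow> real set" where
  "level_set a \<omega> = {t. 0 \<le> t \<and> B t \<omega> = a}"

end

theory Submission
  imports Defs
begin

text \<open>Under every law \<open>P\<close> of the family the coordinate process is a continuous martingale: a
  \<open>G\<close>-normal variable \<open>X\<close> has mean zero in both directions, \<open>E[X] = E[-X] = 0\<close>, because
  \<open>X + X'\<close> has the law of \<open>sqrt 2 X\<close>; hence increments multiplied by nonnegative functions of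
  the past have sublinear expectation zero in both directions, and the linear expectation under
  \<open>P\<close>, which lies below the sublinear one, must vanish (\<open>G_normal_mean_zero\<close>,
  \<open>past_times_increment_le\<close>, \<open>past_fair\<close>).

  Almost surely a level set of a continuous martingale has no isolated points.  Suppose \<open>t\<close> is an isolated
  zero of \<open>X = B - a\<close>.  Choose rationals \<open>p \<le> t < q\<close> such that \<open>t\<close> is the only zero in
  \<open>[p, q]\<close>; after a change of sign \<open>X > 0\<close> on \<open>(t, q]\<close>.  Then \<open>t\<close> is the first zero from the
  rational time \<open>p\<close> on, so it is a value of a stopping time.  Started from zero at that time and stopped
  as soon as it becomes negative, a continuous martingale has mean zero and no negative part, so
  it cannot be positive at time \<open>q\<close> with positive probability.  There are countably
  many choices of \<open>p\<close>, \<open>q\<close> and the sign, and the exceptional set built from them does not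
  depend on \<open>P\<close>, so it is polar.

  The stopping argument is carried out on the equidistant grids of \<open>[p, q]\<close>.  There the process is
  started at the first grid time with \<open>0 \<le> X \<le> \<delta>\<close> and stopped at the next grid time with
  \<open>X < 0\<close>.  The pathwise inequality \<open>active_value_le\<close> bounds the value of the process that has not
  been stopped by martingale increments, an error \<open>2 \<delta>\<close>, and \<open>\<bar>X q\<bar>\<close> on the event
  that some step of the grid exceeds \<open>\<delta>\<close>.  Refining the grid and then letting
  \<open>\<delta>\<close> tend to zero gives \<open>AE_not_escapes\<close>; isolated zeros are
  related to this event by \<open>isolated_zero_escapes\<close>.\<close>

section \<open>Truncation and bounded Lipschitz functions\<close>

definition trunc :: "real \<Rightarrow> real \<Rightarrow> real" where
  "trunc m x = max (- m) (min m x)"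

lemma abs_trunc_le: "0 \<le> m \<Longrightarrow> \<bar>trunc m x\<bar> \<le> m"
  by (auto simp: trunc_def)

lemma abs_trunc_le_arg: "0 \<le> m \<Longrightarrow> \<bar>trunc m x\<bar> \<le> \<bar>x\<bar>"
  by (auto simp: trunc_def)

lemma trunc_lipschitz: "\<bar>trunc m x - trunc m y\<bar> \<le> \<bar>x - y\<bar>"
  by (auto simp: trunc_def max_def min_def abs_if)

lemma trunc_minus: "0 \<le> m \<Longrightarrow> trunc m (- x) = - trunc m x"
  by (auto simp: trunc_def max_def min_def)

lemma trunc_error:
  assumes "0 < m"
  shows "\<bar>trunc m x - x\<bar> \<le> x\<^sup>2 / m"
proof (cases "\<bar>x\<bar> \<le> m")
  case True
  then have "trunc m x = x" by (auto simp: trunc_def)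
  then show ?thesis using assms by simp
next
  case False
  then have "m * \<bar>x\<bar> \<le> \<bar>x\<bar> * \<bar>x\<bar>" by (intro mult_right_mono) auto
  then have "\<bar>x\<bar> \<le> x\<^sup>2 / m"
    using assms by (simp add: field_simps power2_eq_square)
  moreover have "\<bar>trunc m x - x\<bar> \<le> \<bar>x\<bar>" using assms by (auto simp: trunc_def)
  ultimately show ?thesis by linarith
qed

lemma trunc_eventually_id: "eventually (\<lambda>m. trunc (real m) x = x) sequentially"
proof (rule eventually_mono[OF eventually_ge_at_top[of "nat \<lceil>\<bar>x\<bar>\<rceil>"]])
  fix m assume "nat \<lceil>\<bar>x\<bar>\<rceil> \<le> m"
  then have "\<bar>x\<bar> \<le> real m" by linarith
  then show "trunc (real m) x = x" by (auto simp: trunc_def)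
qed

lemma trunc_measurable [measurable]: "trunc m \<in> borel_measurable borel"
  unfolding trunc_def by measurable

lemma CbLip_const: "CbLip k (\<lambda>_. r)"
  unfolding CbLip_def by (auto intro!: exI[of _ 0] exI[of _ "\<bar>r\<bar>"])

lemma CbLip_mult:
  assumes "CbLip k f" "CbLip k g"
  shows "CbLip k (\<lambda>x. f x * g x)"
proof -
  obtain C1 L1 where f: "\<And>x. length x = k \<Longrightarrow> \<bar>f x\<bar> \<le> C1"
    "\<And>x y. length x = k \<Longrightarrow> length y = k \<Longrightarrow> \<bar>f x - f y\<bar> \<le> L1 * L2_set (\<lambda>i. x ! i - y ! i) {..<k}"
    using assms(1) unfolding CbLip_def by meson
  obtain C2 L2 where g: "\<And>x. length x = k \<Longrightarrow> \<bar>g x\<bar> \<le> C2"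
    "\<And>x y. length x = k \<Longrightarrow> length y = k \<Longrightarrow> \<bar>g x - g y\<bar> \<le> L2 * L2_set (\<lambda>i. x ! i - y ! i) {..<k}"
    using assms(2) unfolding CbLip_def by meson
  have "\<bar>f x * g x\<bar> \<le> C1 * C2" if "length x = k" for x
    unfolding abs_mult using f(1)[OF that] g(1)[OF that] by (intro mult_mono) auto
  moreover have "\<bar>f x * g x - f y * g y\<bar> \<le> (C1 * L2 + C2 * L1) * L2_set (\<lambda>i. x ! i - y ! i) {..<k}"
    if x: "length x = k" and y: "length y = k" for x y
  proof -
    let ?d = "L2_set (\<lambda>i. x ! i - y ! i) {..<k}"
    have "\<bar>f x * g x - f y * g y\<bar> = \<bar>f x * (g x - g y) + g y * (f x - f y)\<bar>"
      by (simp add: algebra_simps)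
    also have "\<dots> \<le> \<bar>f x\<bar> * \<bar>g x - g y\<bar> + \<bar>g y\<bar> * \<bar>f x - f y\<bar>"
      by (metis abs_mult abs_triangle_ineq)
    also have "\<dots> \<le> C1 * (L2 * ?d) + C2 * (L1 * ?d)"
      using f(1)[OF x] g(1)[OF y] f(2)[OF x y] g(2)[OF x y] by (intro add_mono mult_mono) auto
    finally show ?thesis by (simp add: algebra_simps)
  qed
  ultimately show ?thesis unfolding CbLip_def by blast
qed

lemma CbLip_prod:
  assumes "\<And>i. i \<in> I \<Longrightarrow> CbLip k (f i)"
  shows "CbLip k (\<lambda>x. \<Prod>i\<in>I. f i x)"
  using assms by (induction I rule: infinite_finite_induct) (auto intro: CbLip_const CbLip_mult)

text \<open>Every test function below is a product of such functions: the value of a path at a time of the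
  grid is a linear form in the increments.\<close>

lemma CbLip_ridge:
  fixes g :: "real \<Rightarrow> real" and c :: "nat \<Rightarrow> real"
  assumes bdd: "\<And>z. \<bar>g z\<bar> \<le> C" and lip: "\<And>z z'. \<bar>g z - g z'\<bar> \<le> L * \<bar>z - z'\<bar>"
  shows "CbLip k (\<lambda>x. g (\<Sum>j<k. c j * x ! j))"
proof -
  have "\<bar>L\<bar> * \<bar>z - z'\<bar> \<ge> L * \<bar>z - z'\<bar>" for z z' by (intro mult_right_mono) auto
  then have lip': "\<bar>g z - g z'\<bar> \<le> \<bar>L\<bar> * \<bar>z - z'\<bar>" for z z' using lip[of z z'] by (meson order_trans)
  have "\<bar>g (\<Sum>j<k. c j * x ! j) - g (\<Sum>j<k. c j * y ! j)\<bar>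
      \<le> (\<bar>L\<bar> * (\<Sum>j<k. \<bar>c j\<bar>)) * L2_set (\<lambda>i. x ! i - y ! i) {..<k}" for x y :: "real list"
  proof -
    let ?d = "L2_set (\<lambda>i. x ! i - y ! i) {..<k}"
    have "\<bar>(\<Sum>j<k. c j * x ! j) - (\<Sum>j<k. c j * y ! j)\<bar> = \<bar>\<Sum>j<k. c j * (x ! j - y ! j)\<bar>"
      by (simp add: sum_subtractf algebra_simps)
    also have "\<dots> \<le> (\<Sum>j<k. \<bar>c j\<bar> * \<bar>x ! j - y ! j\<bar>)"
      using sum_abs[of "\<lambda>j. c j * (x ! j - y ! j)" "{..<k}"] by (simp add: abs_mult)
    also have "\<dots> \<le> (\<Sum>j<k. \<bar>c j\<bar> * ?d)"
    proof (intro sum_mono mult_left_mono)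
      fix j assume "j \<in> {..<k}"
      then have "\<bar>x ! j - y ! j\<bar> \<le> L2_set (\<lambda>i. \<bar>x ! i - y ! i\<bar>) {..<k}"
        by (intro member_le_L2_set) auto
      then show "\<bar>x ! j - y ! j\<bar> \<le> ?d" by (simp add: L2_set_def)
    qed auto
    finally have "\<bar>L\<bar> * \<bar>(\<Sum>j<k. c j * x ! j) - (\<Sum>j<k. c j * y ! j)\<bar> \<le> \<bar>L\<bar> * ((\<Sum>j<k. \<bar>c j\<bar>) * ?d)"
      by (intro mult_left_mono) (auto simp: sum_distrib_right)
    then show ?thesis using lip'[of "\<Sum>j<k. c j * x ! j" "\<Sum>j<k. c j * y ! j"]
      by (simp add: mult.assoc)
  qed
  then show ?thesis unfolding CbLip_def using bdd by blast
qed

lemma CbLip_coordinate: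
  fixes g :: "real \<Rightarrow> real"
  assumes "\<And>z. \<bar>g z\<bar> \<le> C" "\<And>z z'. \<bar>g z - g z'\<bar> \<le> L * \<bar>z - z'\<bar>" "i < k"
  shows "CbLip k (\<lambda>x. g (r * x ! i))"
proof -
  have "(\<Sum>j<k. (if j = i then r else 0) * x ! j) = r * x ! i" for x :: "real list"
    using assms(3) by (simp add: if_distrib[of "\<lambda>a. a * _"] sum.delta cong: if_cong)
  then show ?thesis
    using CbLip_ridge[OF assms(1,2), of k "\<lambda>j. if j = i then r else 0"] by simp
qed

section \<open>Mean zero of G-normal variables\<close>

context sublinear_expectation_space
begin

lemma const_mem: "(\<lambda>_. r) \<in> H"
  using comp_mem[of "[]" "\<lambda>_. r"] by (simp add: CbLip_const)

lemma lipschitz_mem: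
  fixes g :: "real \<Rightarrow> real"
  assumes "X \<in> H" "\<And>z. \<bar>g z\<bar> \<le> C" "\<And>z z'. \<bar>g z - g z'\<bar> \<le> L * \<bar>z - z'\<bar>"
  shows "(\<lambda>w. g (X w)) \<in> H"
  using comp_mem[of "[X]" "\<lambda>x. g (1 * x ! 0)"] CbLip_coordinate[OF assms(2,3), of 0 1 1] assms(1)
  by (simp add: eval_vec_def)

lemma trunc_mem: "X \<in> H \<Longrightarrow> 0 \<le> m \<Longrightarrow> (\<lambda>w. trunc m (X w)) \<in> H"
  by (rule lipschitz_mem[where C = m and L = 1]) (auto simp: trunc_lipschitz abs_trunc_le)

lemma add_const: 
  assumes "X \<in> H"
  shows "E (\<lambda>w. r + X w) = r + E X"
proof -
  have "E (\<lambda>w. r + X w) \<le> r + E X"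
    using subadditive[OF const_mem assms, of r] by (simp add: constant_preserving)
  moreover have "E (\<lambda>w. - r + (r + X w)) \<le> - r + E (\<lambda>w. r + X w)"
    using subadditive[OF const_mem add_mem[OF const_mem assms], of "- r" r]
    by (simp add: constant_preserving)
  ultimately show ?thesis by simp
qed

lemma abs_diff_le:
  assumes "X \<in> H" "Y \<in> H" "Z \<in> H" "\<And>w. \<bar>X w - Y w\<bar> \<le> Z w"
  shows "\<bar>E X - E Y\<bar> \<le> E Z"
proof -
  have *: "E X - E Y \<le> E Z" if "X \<in> H" "Y \<in> H" "\<And>w. \<bar>X w - Y w\<bar> \<le> Z w" for X Y
  proof -
    have "X w \<le> Z w + Y w" for w using that(3)[of w] by linarith
    then have "E X \<le> E (\<lambda>w. Z w + Y w)"
      using that assms(3) by (intro monotone add_mem)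
    also have "\<dots> \<le> E Z + E Y" by (rule subadditive[OF assms(3) that(2)])
    finally show ?thesis by simp
  qed
  have "E Y - E X \<le> E Z" 
    using assms(4) by (intro *) (auto simp: abs_minus_commute assms)
  with *[OF assms(1,2,4)] show ?thesis by linarith
qed

text \<open>The truncation error is controlled by the second moment.  This is how statements about
  bounded test functions, the only ones that equality in distribution and independence speak
  about, are transferred to unbounded variables.\<close>

lemma trunc_expectation:
  assumes "X \<in> H" "(\<lambda>w. (X w)\<^sup>2) \<in> H" "0 < m"
  shows "\<bar>E (\<lambda>w. trunc m (X w)) - E X\<bar> \<le> E (\<lambda>w. (X w)\<^sup>2) / m"
proof -
  have "\<bar>E (\<lambda>w. trunc m (X w)) - E X\<bar> \<le> E (\<lambda>w. (1 / m) * (X w)\<^sup>2)"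
    using assms trunc_error[OF assms(3)] by (intro abs_diff_le trunc_mem scale_mem) auto
  also have "\<dots> = (1 / m) * E (\<lambda>w. (X w)\<^sup>2)"
    using assms by (intro pos_homogeneous) auto
  finally show ?thesis by simp
qed

text \<open>Let \<open>e\<close> be the expectation of \<open>Z = c X\<close>.  Stability says that \<open>Z + Z'\<close> and \<open>sqrt 2 Z\<close> have the same law,
  so \<open>2 e = sqrt 2 e\<close>.  As \<open>X'\<close> is only known through bounded test functions, and its square
  need not belong to \<open>H\<close>, both sides are compared after truncation at height \<open>m\<close>, and
  the independent copy is replaced by \<open>X\<close> inside the inner expectation before any moment is taken.\<close>

lemma G_normal_mean_zero:
  assumes "G_normal H E G X"
  shows "E (\<lambda>w. c * X w) = 0"
proof -
  define Z where "Z w = c * X w" for w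
  define e where "e = E Z"
  define v where "v = E (\<lambda>w. (Z w)\<^sup>2)"
  obtain X' where XH: "X \<in> H" and X2: "(\<lambda>w. (X w)\<^sup>2) \<in> H" and X'H: "X' \<in> H"
    and d: "eq_in_dist E X' X" and ind: "indep_from E X' [X]"
    and stable: "\<And>a b. a \<ge> 0 \<Longrightarrow> b \<ge> 0 \<Longrightarrow>
      eq_in_dist E (\<lambda>w. a * X w + b * X' w) (\<lambda>w. sqrt (a\<^sup>2 + b\<^sup>2) * X w)"
    using assms unfolding G_normal_def by blast
  have ZH: "Z \<in> H" unfolding Z_def by (rule scale_mem[OF XH])
  have Z2: "(\<lambda>w. (Z w)\<^sup>2) \<in> H"
    using scale_mem[OF X2, of "c\<^sup>2"] by (simp add: Z_def power_mult_distrib)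
  have v0: "0 \<le> v"
    using monotone[OF const_mem Z2, of 0] by (simp add: v_def constant_preserving)
  have bound: "\<bar>2 * e - sqrt 2 * e\<bar> \<le> 6 * v / m" if m: "0 < m" for m
  proof -
    define u where "u x = E (\<lambda>w. trunc m (c * x + Z w))" for x
    have shift: "(\<lambda>w. r + Z w) \<in> H" "(\<lambda>w. (r + Z w)\<^sup>2) \<in> H" for r
    proof -
      show "(\<lambda>w. r + Z w) \<in> H" by (rule add_mem[OF const_mem ZH])
      have "(\<lambda>w. r\<^sup>2 + (2 * r * Z w + (Z w)\<^sup>2)) \<in> H"
        by (intro add_mem const_mem scale_mem ZH Z2)
      then show "(\<lambda>w. (r + Z w)\<^sup>2) \<in> H" by (simp add: power2_sum algebra_simps)
    qed
    \<comment> \<open>\<open>u x\<close> is the inner expectation in the independence identity; up to \<open>O(1 / m)\<close> it is affine.\<close>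
    have u_approx: "\<bar>u x - (c * x + e)\<bar> \<le> (2 * (c * x)\<^sup>2 + 2 * v) / m" for x
    proof -
      have "\<bar>u x - (c * x + e)\<bar> \<le> E (\<lambda>w. (c * x + Z w)\<^sup>2) / m"
        using trunc_expectation[OF shift[of "c * x"] m] add_const[OF ZH, of "c * x"]
        by (simp add: u_def e_def)
      also have "E (\<lambda>w. (c * x + Z w)\<^sup>2) \<le> E (\<lambda>w. 2 * (c * x)\<^sup>2 + 2 * (Z w)\<^sup>2)"
      proof (intro monotone shift add_mem const_mem scale_mem Z2)
        show "(c * x + Z w)\<^sup>2 \<le> 2 * (c * x)\<^sup>2 + 2 * (Z w)\<^sup>2" for w
          using sum_squares_ge_zero[of "c * x - Z w" 0]
          by (simp add: power2_sum power2_diff power2_eq_square algebra_simps)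
      qed
      also have "\<dots> = 2 * (c * x)\<^sup>2 + 2 * v"
        using add_const[OF scale_mem[OF Z2, of 2]] pos_homogeneous[OF Z2, of 2]
        by (simp add: v_def)
      finally show ?thesis using m by (simp add: divide_right_mono)
    qed
    have u_mem: "(\<lambda>w. u (X w)) \<in> H"
    proof (rule lipschitz_mem[OF XH, where C = m and L = "\<bar>c\<bar>"])
      show "\<bar>u x\<bar> \<le> m" for x
        using abs_diff_le[OF trunc_mem[OF shift(1)] const_mem[of 0] const_mem[of m], of m "c * x"]
          abs_trunc_le[of m] m by (simp add: u_def constant_preserving)
      show "\<bar>u x - u y\<bar> \<le> \<bar>c\<bar> * \<bar>x - y\<bar>" for x y
      proof -
        have "\<bar>u x - u y\<bar> \<le> E (\<lambda>_. \<bar>c\<bar> * \<bar>x - y\<bar>)"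
          unfolding u_def
        proof (intro abs_diff_le trunc_mem shift const_mem)
          show "\<bar>trunc m (c * x + Z w) - trunc m (c * y + Z w)\<bar> \<le> \<bar>c\<bar> * \<bar>x - y\<bar>" for w
            using trunc_lipschitz[of m "c * x + Z w" "c * y + Z w"]
            by (simp add: abs_mult flip: right_diff_distrib)
        qed (use m in auto)
        then show ?thesis by (simp add: constant_preserving)
      qed
    qed
    have lip1: "CbLip 1 (\<lambda>x. trunc m (r + c * x ! 0))" for r
      by (rule CbLip_coordinate[where C = m and L = 1])
        (use m in \<open>auto simp: abs_trunc_le intro: order_trans[OF trunc_lipschitz]\<close>)
    have "E (\<lambda>w. trunc m (sqrt 2 * Z w)) = E (\<lambda>w. trunc m (c * (X w + X' w)))"
    proof -
      have "eq_in_dist E (\<lambda>w. 1 * X w + 1 * X' w) (\<lambda>w. sqrt (1\<^sup>2 + 1\<^sup>2) * X w)"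
        by (rule stable) auto
      then show ?thesis
        using lip1[of 0] unfolding eq_in_dist_def Z_def
        by (elim allE[of _ "\<lambda>x. trunc m (0 + c * x ! 0)"]) (simp add: mult.left_commute)
    qed
    also have "\<dots> = E (\<lambda>w. E (\<lambda>w'. trunc m (c * (X w + X' w'))))"
    proof -
      have "(\<Sum>j<Suc (Suc 0). c * x ! j) = c * (x ! 0 + x ! 1)" for x :: "real list"
        by (simp add: algebra_simps)
      then have "CbLip (Suc (length [X])) (\<lambda>x. trunc m (c * (x ! 0 + x ! 1)))"
        using CbLip_ridge[of "trunc m" m 1 "Suc (Suc 0)" "\<lambda>_. c"] m
        by (simp add: abs_trunc_le trunc_lipschitz)
      then show ?thesis using ind unfolding indep_from_def by (fastforce simp: eval_vec_def)
    qed
    also have "\<dots> = E (\<lambda>w. u (X w))"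
    proof -
      have "E (\<lambda>w'. trunc m (c * (x + X' w'))) = u x" for x
        using d lip1[of "c * x"] unfolding eq_in_dist_def u_def Z_def
        by (elim allE[of _ "\<lambda>y. trunc m (c * x + c * y ! 0)"]) (simp add: distrib_left)
      then show ?thesis by simp
    qed
    finally have eq: "E (\<lambda>w. trunc m (sqrt 2 * Z w)) = E (\<lambda>w. u (X w))" .
    have "\<bar>E (\<lambda>w. trunc m (sqrt 2 * Z w)) - E (\<lambda>w. sqrt 2 * Z w)\<bar> \<le> E (\<lambda>w. (sqrt 2 * Z w)\<^sup>2) / m"
      using trunc_expectation[OF scale_mem[OF ZH, of "sqrt 2"] _ m] scale_mem[OF Z2, of 2]
      by (simp add: power_mult_distrib)
    then have 1: "\<bar>E (\<lambda>w. trunc m (sqrt 2 * Z w)) - sqrt 2 * e\<bar> \<le> 2 * v / m"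
      using pos_homogeneous[OF ZH, of "sqrt 2"] pos_homogeneous[OF Z2, of 2]
      by (simp add: power_mult_distrib e_def v_def)
    have "\<bar>E (\<lambda>w. u (X w)) - E (\<lambda>w. e + Z w)\<bar> \<le> E (\<lambda>w. 2 * v / m + 2 / m * (Z w)\<^sup>2)"
    proof (intro abs_diff_le u_mem shift add_mem const_mem scale_mem Z2)
      show "\<bar>u (X w) - (e + Z w)\<bar> \<le> 2 * v / m + 2 / m * (Z w)\<^sup>2" for w
        using u_approx[of "X w"] by (simp add: Z_def add.commute add_divide_distrib)
    qed
    also have "\<dots> = 4 * v / m"
      using add_const[OF scale_mem[OF Z2, of "2 / m"]] pos_homogeneous[OF Z2, of "2 / m"] m
      by (simp add: v_def)
    finally have 2: "\<bar>E (\<lambda>w. u (X w)) - 2 * e\<bar> \<le> 4 * v / m"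
      using add_const[OF ZH, of e] by (simp add: e_def)
    have "6 * v / m = 2 * v / m + 4 * v / m" by (simp add: add_divide_distrib[symmetric])
    with 1 2 eq show ?thesis by linarith
  qed
  have "2 * e - sqrt 2 * e = 0"
  proof (rule ccontr)
    assume ne: "2 * e - sqrt 2 * e \<noteq> 0"
    define b where "b = \<bar>2 * e - sqrt 2 * e\<bar>"
    have b: "0 < b" using ne by (simp add: b_def)
    have "b \<le> 6 * v / ((6 * v + 1) / b)"
      unfolding b_def[symmetric] using bound[of "(6 * v + 1) / b"] v0 b by (simp add: b_def)
    then show False using b v0 by (simp add: field_simps)
  qed
  then have "(2 - sqrt 2) * e = 0" by (simp add: algebra_simps)
  then have "e = 0" by (simp add: real_sqrt_eq_iff[of 2 4, simplified])
  then show ?thesis by (simp add: e_def Z_def[abs_def])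
qed

end

section \<open>A pathwise inequality for sampled paths\<close>

text \<open>A sequence of samples is waiting until it first enters \<open>[0, \<delta>]\<close>, then active while it stays
  nonnegative; once it becomes negative after that, it is neither, for ever.\<close>

definition waiting :: "(nat \<Rightarrow> real) \<Rightarrow> real \<Rightarrow> nat \<Rightarrow> bool" where
  "waiting x \<delta> k \<longleftrightarrow> (\<forall>j\<le>k. \<not> (0 \<le> x j \<and> x j \<le> \<delta>))"

primrec active :: "(nat \<Rightarrow> real) \<Rightarrow> real \<Rightarrow> nat \<Rightarrow> bool" where
  "active x \<delta> 0 \<longleftrightarrow> 0 \<le> x 0 \<and> x 0 \<le> \<delta>"
| "active x \<delta> (Suc k) \<longleftrightarrow>
     0 \<le> x (Suc k) \<and> (active x \<delta> k \<or> waiting x \<delta> k \<and> x (Suc k) \<le> \<delta>)"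

lemma waiting_Suc: "waiting x \<delta> (Suc k) \<longleftrightarrow> waiting x \<delta> k \<and> \<not> (0 \<le> x (Suc k) \<and> x (Suc k) \<le> \<delta>)"
  unfolding waiting_def by (auto simp: le_Suc_eq)

lemma active_nonneg: "active x \<delta> k \<Longrightarrow> 0 \<le> x k"
  by (cases k) auto

lemma active_not_waiting: "active x \<delta> k \<Longrightarrow> \<not> waiting x \<delta> k"
  by (induction k) (auto simp: waiting_def[of _ _ 0] waiting_Suc)

text \<open>The hypothesis on the samples before \<open>k\<close> excludes that the sequence became active early and
  was stopped before time \<open>k\<close>: a negative sequence keeps waiting, a nonnegative one is never stopped.\<close>

lemma active_from_hit:
  assumes hit: "x k \<le> \<delta>" and "k \<le> n"
    and before: "(\<forall>j<k. x j < 0) \<or> (\<forall>j<k. 0 \<le> x j)"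
    and after: "\<And>j. k \<le> j \<Longrightarrow> j \<le> n \<Longrightarrow> 0 \<le> x j"
  shows "active x \<delta> n"
proof -
  have at_k: "active x \<delta> k"
  proof (cases "\<forall>j<k. x j < 0")
    case True
    then have "waiting x \<delta> j" if "j < k" for j using that
      unfolding waiting_def by (meson le_less_trans not_less)
    then show ?thesis using hit after[of k] assms(2) by (cases k) auto
  next
    case False
    then have nn: "\<forall>j<k. 0 \<le> x j" using before by blast
    have "active x \<delta> j \<or> waiting x \<delta> j" if "j < k" for j
      using that
    proof (induction j)
      case 0 then show ?case using nn by (auto simp: waiting_def)
    next
      case (Suc j) then show ?case using nn by (auto simp: waiting_Suc)
    qed
    then show ?thesis
      using hit after[of k] assms(2) nn by (cases k) auto
  qed
  from \<open>k \<le> n\<close> after show ?thesis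
    by (induction n rule: dec_induct) (use at_k in auto)
qed

text \<open>This is optional stopping at the level of a single path.  The summands of \<open>gains\<close> have mean
  zero for a martingale with final value \<open>y\<close>.  The first kind accumulates the increments while the sequence is active.
  The second kind deals with the overshoot when the sequence is stopped: an
  overshoot below \<open>- \<delta>\<close> is traded for the final value \<open>y\<close>, which is harmless since it happens only if some step
  exceeds \<open>\<delta>\<close>, an event on which the integrable \<open>y\<close> contributes little for fine grids.\<close>

lemma active_value_le:
  fixes x :: "nat \<Rightarrow> real" and y :: real
  assumes "0 \<le> \<delta>"
  defines "gains \<equiv> \<lambda>n. \<Sum>k<n. of_bool (active x \<delta> k) * (x (Suc k) - x k)
      + of_bool (active x \<delta> k \<and> x (Suc k) < - \<delta>) * (y - x (Suc k))"
  shows "(if active x \<delta> n then x n else 0)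
    \<le> gains n + 2 * \<delta> + of_bool (\<exists>k<n. \<bar>x (Suc k) - x k\<bar> > \<delta>) * \<bar>y\<bar>"
proof -
  define jump where "jump n \<longleftrightarrow> (\<exists>k<n. \<bar>x (Suc k) - x k\<bar> > \<delta>)" for n
  have jump_Suc: "jump (Suc n) \<longleftrightarrow> jump n \<or> \<bar>x (Suc n) - x n\<bar> > \<delta>" for n
    by (auto simp: jump_def less_Suc_eq)
  have gains_Suc: "gains (Suc n) = gains n + (of_bool (active x \<delta> n) * (x (Suc n) - x n)
      + of_bool (active x \<delta> n \<and> x (Suc n) < - \<delta>) * (y - x (Suc n)))" for n
    by (simp add: gains_def)
  \<comment> \<open>The three phases: nothing gained yet; the gains follow \<open>x n\<close> up to the starting value; the
    balance has been settled by the overshoot.\<close>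
  have inv: "(waiting x \<delta> n \<longrightarrow> gains n = 0) \<and> (active x \<delta> n \<longrightarrow> x n \<le> gains n + \<delta>) \<and>
    (\<not> waiting x \<delta> n \<longrightarrow> \<not> active x \<delta> n \<longrightarrow> 0 \<le> gains n + 2 * \<delta> + of_bool (jump n) * \<bar>y\<bar>)"
  proof (induction n)
    case 0 then show ?case by (auto simp: gains_def waiting_def)
  next
    case (Suc n)
    consider (a) "active x \<delta> n" | (w) "waiting x \<delta> n" "\<not> active x \<delta> n"
      | (e) "\<not> waiting x \<delta> n" "\<not> active x \<delta> n" by blast
    then show ?case
    proof cases
      case a
      then have nw: "\<not> waiting x \<delta> n" and xn: "0 \<le> x n" "x n \<le> gains n + \<delta>"
        using active_not_waiting active_nonneg Suc by auto
      consider "0 \<le> x (Suc n)" | "- \<delta> \<le> x (Suc n)" "x (Suc n) < 0" | "x (Suc n) < - \<delta>"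
        by linarith
      then show ?thesis
      proof cases
        case 1
        then show ?thesis using a nw xn assms(1) by (auto simp: waiting_Suc gains_Suc)
      next
        case 2
        then have "gains (Suc n) = gains n + (x (Suc n) - x n)" using a by (simp add: gains_Suc)
        then have "0 \<le> gains (Suc n) + 2 * \<delta>" using xn 2 by linarith
        then show ?thesis using a nw 2 by (auto simp: waiting_Suc)
      next
        case 3
        then have "gains (Suc n) = gains n + (y - x n)" using a by (simp add: gains_Suc)
        moreover have "jump (Suc n)" using 3 xn by (auto simp: jump_Suc)
        ultimately show ?thesis using a nw 3 xn assms(1) by (auto simp: waiting_Suc)
      qed
    next
      case w
      then have "gains (Suc n) = 0" using Suc by (simp add: gains_Suc)
      then show ?thesis using w assms(1) by (auto simp: waiting_Suc)
    next
      case e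
      then have "gains (Suc n) = gains n" by (simp add: gains_Suc)
      moreover have "of_bool (jump n) * \<bar>y\<bar> \<le> of_bool (jump (Suc n)) * \<bar>y\<bar>"
        by (intro mult_right_mono) (auto simp: jump_Suc)
      ultimately show ?thesis using e Suc by (auto simp: waiting_Suc simp del: of_bool_eq_iff)
    qed
  qed
  have "0 \<le> of_bool (jump n) * \<bar>y\<bar>" by simp
  then show ?thesis using inv assms(1) unfolding jump_def[symmetric] by (auto split: if_splits)
qed

declare active.simps [simp del]

section \<open>Continuous martingales do not escape from zero\<close>

definition grid :: "real \<Rightarrow> real \<Rightarrow> nat \<Rightarrow> nat \<Rightarrow> real" where
  "grid p q N k = p + (q - p) * real k / real N"

lemma grid_props:
  assumes "p < q" "0 < N"
  shows "grid p q N N = q" "j \<le> k \<Longrightarrow> grid p q N j \<le> grid p q N k" "p \<le> grid p q N k"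
    "grid p q N (Suc k) = grid p q N k + (q - p) / real N"
    "k \<le> N \<Longrightarrow> grid p q N k \<le> q"
proof -
  show "grid p q N N = q" using assms by (simp add: grid_def)
  show mono: "grid p q N j \<le> grid p q N k" if "j \<le> k" for j k
    using assms that by (auto simp: grid_def intro!: divide_right_mono mult_left_mono)
  show "p \<le> grid p q N k" using assms by (simp add: grid_def)
  show "grid p q N (Suc k) = grid p q N k + (q - p) / real N" 
    by (simp add: grid_def add_divide_distrib distrib_left)
  show "grid p q N k \<le> q" if "k \<le> N" using mono[OF that] \<open>grid p q N N = q\<close> by simp
qed

text \<open>A measurable substitute for having exactly one zero in \<open>[p, q)\<close> and being positive from there up to \<open>q\<close>.
  It quantifies over countably many grids and tolerances only, and it refers to the path
  alone, so that the same set of paths serves all laws.\<close>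

definition escapes :: "(real \<Rightarrow> real) \<Rightarrow> real \<Rightarrow> real \<Rightarrow> bool" where
  "escapes f p q \<longleftrightarrow> 0 < f q \<and> (\<forall>m. \<exists>N0. \<forall>N\<ge>N0.
     active (\<lambda>k. f (grid p q (Suc N) k)) (1 / real (Suc m)) (Suc N))"

locale continuous_martingale = prob_space M
  for M :: "'a measure" +
  fixes F :: "real \<Rightarrow> 'a measure" and X :: "real \<Rightarrow> 'a \<Rightarrow> real"
  assumes subalg: "0 \<le> t \<Longrightarrow> subalgebra M (F t)"
    and adapted: "0 \<le> s \<Longrightarrow> s \<le> t \<Longrightarrow> X s \<in> borel_measurable (F t)"
    and integrable_X: "0 \<le> t \<Longrightarrow> integrable M (X t)"
    and fair: "0 \<le> s \<Longrightarrow> s \<le> t \<Longrightarrow> A \<in> sets (F s) \<Longrightarrow>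
      (\<integral>\<omega>. indicator A \<omega> * (X t \<omega> - X s \<omega>) \<partial>M) = 0"
    and continuous_paths: "\<omega> \<in> space M \<Longrightarrow> continuous_on {0..} (\<lambda>t. X t \<omega>)"
begin

lemma affine: "continuous_martingale M F (\<lambda>t \<omega>. c * (X t \<omega> - a))"
proof
  fix s t :: real
  show "0 \<le> t \<Longrightarrow> subalgebra M (F t)" by (rule subalg)
  show "0 \<le> s \<Longrightarrow> s \<le> t \<Longrightarrow> (\<lambda>\<omega>. c * (X s \<omega> - a)) \<in> borel_measurable (F t)"
    using adapted[of s t] by measurable
  show "0 \<le> t \<Longrightarrow> integrable M (\<lambda>\<omega>. c * (X t \<omega> - a))" using integrable_X by auto
  show "(\<integral>\<omega>. indicator A \<omega> * (c * (X t \<omega> - a) - c * (X s \<omega> - a)) \<partial>M) = 0"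
    if "0 \<le> s" "s \<le> t" "A \<in> sets (F s)" for A
  proof -
    have eq: "indicator A \<omega> * (c * (X t \<omega> - a) - c * (X s \<omega> - a))
        = c * (indicator A \<omega> * (X t \<omega> - X s \<omega>))" for \<omega>
      by (simp add: algebra_simps)
    show ?thesis unfolding eq using fair[OF that] by (simp del: mult_eq_0_iff)
  qed
  show "continuous_on {0..} (\<lambda>t. c * (X t \<omega> - a))" if "\<omega> \<in> space M" for \<omega>
    using continuous_paths[OF that] by (intro continuous_intros)
qed

lemma fair_pred:
  assumes "0 \<le> s" "s \<le> t" "{\<omega> \<in> space M. Q \<omega>} \<in> sets (F s)"
  shows "integrable M (\<lambda>\<omega>. of_bool (Q \<omega>) * (X t \<omega> - X s \<omega>))"
    and "(\<integral>\<omega>. of_bool (Q \<omega>) * (X t \<omega> - X s \<omega>) \<partial>M) = 0"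
proof -
  let ?A = "{\<omega> \<in> space M. Q \<omega>}"
  have A: "?A \<in> sets M" using subalg[OF assms(1)] assms(3) by (auto simp: subalgebra_def)
  have "integrable M (\<lambda>\<omega>. indicator ?A \<omega> * (X t \<omega> - X s \<omega>))"
    using integrable_real_mult_indicator[OF A, of "\<lambda>\<omega>. X t \<omega> - X s \<omega>"] assms
      integrable_X[of t] integrable_X[of s] by (simp add: mult.commute)
  moreover have eq: "of_bool (Q \<omega>) * (X t \<omega> - X s \<omega>) = indicator ?A \<omega> * (X t \<omega> - X s \<omega>)"
    if "\<omega> \<in> space M" for \<omega> using that by (auto simp: indicator_def)
  ultimately show "integrable M (\<lambda>\<omega>. of_bool (Q \<omega>) * (X t \<omega> - X s \<omega>))"
    using Bochner_Integration.integrable_cong[of M M "\<lambda>\<omega>. of_bool (Q \<omega>) * (X t \<omega> - X s \<omega>)"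
        "\<lambda>\<omega>. indicator ?A \<omega> * (X t \<omega> - X s \<omega>)", OF refl eq, THEN iffD2] by simp
  show "(\<integral>\<omega>. of_bool (Q \<omega>) * (X t \<omega> - X s \<omega>) \<partial>M) = 0"
    using fair[OF assms] Bochner_Integration.integral_cong[of M M "\<lambda>\<omega>. of_bool (Q \<omega>) * (X t \<omega> - X s \<omega>)"
        "\<lambda>\<omega>. indicator ?A \<omega> * (X t \<omega> - X s \<omega>)", OF refl eq] by simp
qed

lemma measurable_X [measurable]: "0 \<le> t \<Longrightarrow> X t \<in> borel_measurable M"
  using integrable_X by auto

context
  fixes p q :: real
  assumes p: "0 \<le> p" and pq: "p < q"
begin

abbreviation (input) samples :: "nat \<Rightarrow> 'a \<Rightarrow> nat \<Rightarrow> real" where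
  "samples N \<omega> k \<equiv> X (grid p q N k) \<omega>"

lemma active_in_filtration:
  assumes N: "0 < N" and k: "j \<le> k"
  shows "{\<omega> \<in> space M. active (samples N \<omega>) \<delta> j} \<in> sets (F (grid p q N k))"
proof -
  have g0: "0 \<le> grid p q N j" for j using grid_props(3)[OF pq N, of j] p by linarith
  have sp: "space (F (grid p q N j)) = space M" for j
    using subalg[OF g0] by (simp add: subalgebra_def)
  have m: "X (grid p q N i) \<in> borel_measurable (F (grid p q N j))" if "i \<le> j" for i j
    using adapted[OF g0 grid_props(2)[OF pq N that]] .
  have W: "Measurable.pred (F (grid p q N k)) (\<lambda>\<omega>. waiting (samples N \<omega>) \<delta> j)" if "j \<le> k" for j k
  proof -
    have "Measurable.pred (F (grid p q N k)) (\<lambda>\<omega>. \<not> (0 \<le> samples N \<omega> i \<and> samples N \<omega> i \<le> \<delta>))"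
      if "i \<in> {..j}" for i
    proof -
      have "X (grid p q N i) \<in> borel_measurable (F (grid p q N k))"
        using m[of i k] that \<open>j \<le> k\<close> by auto
      moreover have "Measurable.pred borel (\<lambda>x :: real. \<not> (0 \<le> x \<and> x \<le> \<delta>))" by measurable
      ultimately show ?thesis by (rule measurable_compose)
    qed
    then have "Measurable.pred (F (grid p q N k))
        (\<lambda>\<omega>. \<forall>i\<in>{..j}. \<not> (0 \<le> samples N \<omega> i \<and> samples N \<omega> i \<le> \<delta>))"
      by (rule pred_intros_finite(3)[OF finite_atMost])
    then show ?thesis unfolding waiting_def by (simp only: atMost_iff Ball_def)
  qed
  have A: "Measurable.pred (F (grid p q N k)) (\<lambda>\<omega>. active (samples N \<omega>) \<delta> j)" if "j \<le> k" for j k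
    using that
  proof (induction j)
    case 0
    have "Measurable.pred borel (\<lambda>x :: real. 0 \<le> x \<and> x \<le> \<delta>)" by measurable
    from measurable_compose[OF m[of 0 k] this] show ?case by (simp add: active.simps)
  next
    case (Suc j)
    then have "X (grid p q N (Suc j)) \<in> borel_measurable (F (grid p q N k))"
      "Measurable.pred (F (grid p q N k)) (\<lambda>\<omega>. waiting (samples N \<omega>) \<delta> j)"
      "Measurable.pred (F (grid p q N k)) (\<lambda>\<omega>. active (samples N \<omega>) \<delta> j)"
      using m[of "Suc j" k] W[of j k] by auto
    note [measurable] = this
    show ?case unfolding active.simps by measurable
  qed
  show ?thesis using A[OF k] by (simp add: pred_def sp)
qed

lemma active_measurable [measurable]:
  assumes "0 < N"
  shows "Measurable.pred M (\<lambda>\<omega>. active (samples N \<omega>) \<delta> k)"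
  using active_in_filtration[OF assms order_refl, of \<delta> k] subalg[of "grid p q N k"]
    grid_props(3)[OF pq assms, of k] p
  by (auto simp: subalgebra_def pred_def)

text \<open>All gains in \<open>active_value_le\<close> average to zero, because whether the process is active at a
  grid time is decided by the past of that time.\<close>

lemma expectation_active_le:
  assumes N: "0 < N" and \<delta>: "0 \<le> \<delta>"
  shows "(\<integral>\<omega>. of_bool (active (samples N \<omega>) \<delta> N) * X q \<omega> \<partial>M)
    \<le> 2 * \<delta> + (\<integral>\<omega>. of_bool (\<exists>k<N. \<bar>samples N \<omega> (Suc k) - samples N \<omega> k\<bar> > \<delta>) * \<bar>X q \<omega>\<bar> \<partial>M)"
proof -
  let ?x = "samples N"
  define g where "g k \<omega> = of_bool (active (?x \<omega>) \<delta> k) * (?x \<omega> (Suc k) - ?x \<omega> k)" for k \<omega>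
  define h where "h k \<omega> = of_bool (active (?x \<omega>) \<delta> k \<and> ?x \<omega> (Suc k) < - \<delta>)
      * (X q \<omega> - ?x \<omega> (Suc k))" for k \<omega>
  have g0: "0 \<le> grid p q N j" for j using grid_props(3)[OF pq N, of j] p by linarith
  have q0: "0 \<le> q" using p pq by simp
  have [measurable]: "(\<lambda>\<omega>. ?x \<omega> k) \<in> borel_measurable M" for k
    using measurable_X[OF g0] .
  have [measurable]: "X q \<in> borel_measurable M" using measurable_X[OF q0] .
  note [measurable] = active_measurable[OF N]
  have g: "integrable M (g k)" "(\<integral>\<omega>. g k \<omega> \<partial>M) = 0" for k
    using fair_pred[OF g0 grid_props(2)[OF pq N, of k "Suc k"] active_in_filtration[OF N order_refl]]
    unfolding g_def by auto
  have h: "integrable M (h k)" "(\<integral>\<omega>. h k \<omega> \<partial>M) = 0" if "k < N" for k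
  proof -
    let ?G = "F (grid p q N (Suc k))"
    have "X (grid p q N (Suc k)) \<in> borel_measurable ?G"
      by (rule adapted[OF g0 order_refl])
    then have "{\<omega> \<in> space ?G. ?x \<omega> (Suc k) < - \<delta>} \<in> sets ?G" by measurable
    then have "{\<omega> \<in> space M. ?x \<omega> (Suc k) < - \<delta>} \<in> sets ?G"
      using subalg[OF g0] by (simp add: subalgebra_def)
    from sets.Int[OF active_in_filtration[OF N, of k "Suc k" \<delta>] this]
    have "{\<omega> \<in> space M. active (?x \<omega>) \<delta> k \<and> ?x \<omega> (Suc k) < - \<delta>} \<in> sets ?G"
      by (simp add: Int_def conj_ac)
    moreover have "grid p q N (Suc k) \<le> q"
      using grid_props(5)[OF pq N, of "Suc k"] that by simp
    ultimately show "integrable M (h k)" "(\<integral>\<omega>. h k \<omega> \<partial>M) = 0"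
      using fair_pred[OF g0] unfolding h_def by auto
  qed
  have osc: "integrable M (\<lambda>\<omega>. of_bool (\<exists>k<N. \<bar>?x \<omega> (Suc k) - ?x \<omega> k\<bar> > \<delta>) * \<bar>X q \<omega>\<bar>)"
    by (rule Bochner_Integration.integrable_bound[OF integrable_X[OF q0]]) (auto simp: of_bool_def)
  have act: "integrable M (\<lambda>\<omega>. of_bool (active (?x \<omega>) \<delta> N) * X q \<omega>)"
    by (rule Bochner_Integration.integrable_bound[OF integrable_X[OF q0]]) (auto simp: of_bool_def)
  have "(\<integral>\<omega>. of_bool (active (?x \<omega>) \<delta> N) * X q \<omega> \<partial>M)
    \<le> (\<integral>\<omega>. (\<Sum>k<N. g k \<omega> + h k \<omega>) + 2 * \<delta>
        + of_bool (\<exists>k<N. \<bar>?x \<omega> (Suc k) - ?x \<omega> k\<bar> > \<delta>) * \<bar>X q \<omega>\<bar> \<partial>M)"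
  proof (intro integral_mono act Bochner_Integration.integrable_add osc Bochner_Integration.integrable_sum g h)
    show "of_bool (active (?x \<omega>) \<delta> N) * X q \<omega> \<le> (\<Sum>k<N. g k \<omega> + h k \<omega>) + 2 * \<delta>
        + of_bool (\<exists>k<N. \<bar>?x \<omega> (Suc k) - ?x \<omega> k\<bar> > \<delta>) * \<bar>X q \<omega>\<bar>" for \<omega>
    proof -
      have "of_bool (active (?x \<omega>) \<delta> N) * X q \<omega> = (if active (?x \<omega>) \<delta> N then ?x \<omega> N else 0)"
        using grid_props(1)[OF pq N] by simp
      then show ?thesis
        using active_value_le[OF \<delta>, of "?x \<omega>" N "X q \<omega>"] by (simp only: g_def h_def)
    qed
  qed auto
  also have "\<dots> = 2 * \<delta> + (\<integral>\<omega>. of_bool (\<exists>k<N. \<bar>?x \<omega> (Suc k) - ?x \<omega> k\<bar> > \<delta>) * \<bar>X q \<omega>\<bar> \<partial>M)"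
  proof -
    have "integrable M (\<lambda>\<omega>. \<Sum>k<N. g k \<omega> + h k \<omega>)"
      using g h by (intro Bochner_Integration.integrable_sum Bochner_Integration.integrable_add) auto
    moreover have "(\<integral>\<omega>. (\<Sum>k<N. g k \<omega> + h k \<omega>) \<partial>M) = (\<Sum>k<N. \<integral>\<omega>. g k \<omega> + h k \<omega> \<partial>M)"
      using g h by (intro Bochner_Integration.integral_sum Bochner_Integration.integrable_add) auto
    moreover have "\<dots> = 0" using g h by simp
    ultimately show ?thesis using osc by (simp add: prob_space)
  qed
  finally show ?thesis .
qed

lemma oscillation_vanishes:
  assumes \<delta>: "0 < \<delta>"
  shows "(\<lambda>N. \<integral>\<omega>. of_bool (\<exists>k<Suc N. \<bar>samples (Suc N) \<omega> (Suc k) - samples (Suc N) \<omega> k\<bar> > \<delta>)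
      * \<bar>X q \<omega>\<bar> \<partial>M) \<longlonglongrightarrow> 0"
proof -
  have q0: "0 \<le> q" using p pq by simp
  have g0: "0 \<le> grid p q (Suc N) j" for N j using grid_props(3)[OF pq, of "Suc N" j] p by simp
  have [measurable]: "(\<lambda>\<omega>. samples (Suc N) \<omega> k) \<in> borel_measurable M" for N k
    using measurable_X[OF g0] .
  have [measurable]: "X q \<in> borel_measurable M" using measurable_X[OF q0] .
  have "(\<lambda>N. \<integral>\<omega>. of_bool (\<exists>k<Suc N. \<bar>samples (Suc N) \<omega> (Suc k) - samples (Suc N) \<omega> k\<bar> > \<delta>)
      * \<bar>X q \<omega>\<bar> \<partial>M) \<longlonglongrightarrow> (\<integral>\<omega>. 0 \<partial>M)"
  proof (rule integral_dominated_convergence[where w = "\<lambda>\<omega>. \<bar>X q \<omega>\<bar>"])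
    show "AE \<omega> in M. (\<lambda>N. of_bool (\<exists>k<Suc N. \<bar>samples (Suc N) \<omega> (Suc k) - samples (Suc N) \<omega> k\<bar> > \<delta>)
      * \<bar>X q \<omega>\<bar>) \<longlonglongrightarrow> 0"
    proof (intro AE_I2 tendsto_eventually)
      fix \<omega> assume \<omega>: "\<omega> \<in> space M"
      have "uniformly_continuous_on {p..q} (\<lambda>t. X t \<omega>)"
        using p by (intro compact_uniformly_continuous continuous_on_subset[OF continuous_paths[OF \<omega>]]) auto
      then obtain d where d: "0 < d" "\<And>s t. s \<in> {p..q} \<Longrightarrow> t \<in> {p..q} \<Longrightarrow> dist t s < d \<Longrightarrow>
          dist (X t \<omega>) (X s \<omega>) < \<delta>"
        using \<delta> unfolding uniformly_continuous_on_def by meson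
      have "(\<lambda>N. (q - p) / real (Suc N)) \<longlonglongrightarrow> 0"
        by (intro LIMSEQ_Suc lim_const_over_n)
      then have "eventually (\<lambda>N. (q - p) / real (Suc N) < d) sequentially"
        using d(1) by (rule order_tendstoD)
      then show "eventually (\<lambda>N. of_bool (\<exists>k<Suc N. \<bar>samples (Suc N) \<omega> (Suc k) - samples (Suc N) \<omega> k\<bar> > \<delta>)
      * \<bar>X q \<omega>\<bar> = 0) sequentially"
      proof (rule eventually_mono)
        fix N assume N: "(q - p) / real (Suc N) < d"
        have "\<bar>samples (Suc N) \<omega> (Suc k) - samples (Suc N) \<omega> k\<bar> < \<delta>" if "k < Suc N" for k
        proof -
          have "dist (X (grid p q (Suc N) (Suc k)) \<omega>) (X (grid p q (Suc N) k) \<omega>) < \<delta>"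
          proof (rule d(2))
            show "grid p q (Suc N) k \<in> {p..q}" "grid p q (Suc N) (Suc k) \<in> {p..q}"
              using that grid_props(3,5)[OF pq, of "Suc N"] by auto
            show "dist (grid p q (Suc N) (Suc k)) (grid p q (Suc N) k) < d"
              using N pq grid_props(4)[OF pq, of "Suc N" k] by (simp add: dist_real_def)
          qed
          then show ?thesis by (simp add: dist_real_def)
        qed
        then show "of_bool (\<exists>k<Suc N. \<bar>samples (Suc N) \<omega> (Suc k) - samples (Suc N) \<omega> k\<bar> > \<delta>)
          * \<bar>X q \<omega>\<bar> = 0" by fastforce
      qed
    qed
  qed (use integrable_X[OF q0] in \<open>auto simp: of_bool_def\<close>)
  then show ?thesis by simp
qed

lemma escapes_measurable [measurable]: "Measurable.pred M (\<lambda>\<omega>. escapes (\<lambda>t. X t \<omega>) p q)"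
proof -
  have [measurable]: "X q \<in> borel_measurable M" using measurable_X p pq by simp
  have [measurable]: "Measurable.pred M (\<lambda>\<omega>. active (samples (Suc N) \<omega>) \<delta> k)" for N \<delta> k
    by (rule active_measurable) simp
  show ?thesis unfolding escapes_def by measurable
qed

text \<open>On the event the process is active at the end of every sufficiently fine grid, so the expectation
  of \<open>X q\<close> there is at most \<open>2 \<delta>\<close> for each \<open>\<delta>\<close>; but \<open>X q\<close> is positive on the event.\<close>

lemma AE_not_escapes: "AE \<omega> in M. \<not> escapes (\<lambda>t. X t \<omega>) p q"
proof -
  let ?Q = "\<lambda>\<omega>. escapes (\<lambda>t. X t \<omega>) p q"
  have q0: "0 \<le> q" using p pq by simp
  have [measurable]: "X q \<in> borel_measurable M" using measurable_X[OF q0] .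
  have [measurable]: "Measurable.pred M (\<lambda>\<omega>. active (samples (Suc N) \<omega>) \<delta> k)" for N \<delta> k
    by (rule active_measurable) simp
  note intq = Bochner_Integration.integrable_bound[OF integrable_X[OF q0]]
  have bound: "(\<integral>\<omega>. of_bool (?Q \<omega>) * X q \<omega> \<partial>M) \<le> 2 * (1 / real (Suc m))" for m
  proof -
    define \<delta> where "\<delta> = 1 / real (Suc m)"
    have \<delta>: "0 < \<delta>" by (simp add: \<delta>_def)
    have lim: "(\<lambda>N. \<integral>\<omega>. of_bool (?Q \<omega> \<and> active (samples (Suc N) \<omega>) \<delta> (Suc N)) * X q \<omega> \<partial>M)
      \<longlonglongrightarrow> (\<integral>\<omega>. of_bool (?Q \<omega>) * X q \<omega> \<partial>M)"
    proof (rule integral_dominated_convergence[where w = "\<lambda>\<omega>. \<bar>X q \<omega>\<bar>"])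
      show "AE \<omega> in M. (\<lambda>N. of_bool (?Q \<omega> \<and> active (samples (Suc N) \<omega>) \<delta> (Suc N)) * X q \<omega>)
        \<longlonglongrightarrow> of_bool (?Q \<omega>) * X q \<omega>"
      proof (intro AE_I2 tendsto_eventually)
        fix \<omega>
        show "eventually (\<lambda>N. of_bool (?Q \<omega> \<and> active (samples (Suc N) \<omega>) \<delta> (Suc N)) * X q \<omega>
          = of_bool (?Q \<omega>) * X q \<omega>) sequentially"
        proof (cases "?Q \<omega>")
          case True
          then obtain N0 where "\<forall>N\<ge>N0. active (samples (Suc N) \<omega>) \<delta> (Suc N)"
            unfolding escapes_def \<delta>_def by blast
          then show ?thesis using True by (auto simp: eventually_sequentially)
        qed simp
      qed
    qed (use integrable_X[OF q0] in \<open>auto simp: of_bool_def\<close>)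
    have upper: "(\<integral>\<omega>. of_bool (?Q \<omega> \<and> active (samples (Suc N) \<omega>) \<delta> (Suc N)) * X q \<omega> \<partial>M)
      \<le> 2 * \<delta> + (\<integral>\<omega>. of_bool (\<exists>k<Suc N. \<bar>samples (Suc N) \<omega> (Suc k) - samples (Suc N) \<omega> k\<bar> > \<delta>)
        * \<bar>X q \<omega>\<bar> \<partial>M)" for N
    proof -
      have "(\<integral>\<omega>. of_bool (?Q \<omega> \<and> active (samples (Suc N) \<omega>) \<delta> (Suc N)) * X q \<omega> \<partial>M)
        \<le> (\<integral>\<omega>. of_bool (active (samples (Suc N) \<omega>) \<delta> (Suc N)) * X q \<omega> \<partial>M)"
      proof (intro integral_mono intq)
        show "of_bool (?Q \<omega> \<and> active (samples (Suc N) \<omega>) \<delta> (Suc N)) * X q \<omega>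
          \<le> of_bool (active (samples (Suc N) \<omega>) \<delta> (Suc N)) * X q \<omega>" for \<omega>
          using active_nonneg[of "samples (Suc N) \<omega>" \<delta> "Suc N"] grid_props(1)[OF pq, of "Suc N"]
          by (auto simp: of_bool_def)
      qed (auto simp: of_bool_def)
      also note expectation_active_le[of "Suc N" \<delta>]
      finally show ?thesis using \<delta> by simp
    qed
    have "(\<integral>\<omega>. of_bool (?Q \<omega>) * X q \<omega> \<partial>M) \<le> 2 * \<delta> + 0"
      by (rule LIMSEQ_le[OF lim tendsto_add[OF tendsto_const oscillation_vanishes[OF \<delta>]]])
        (use upper in blast)
    then show ?thesis by (simp add: \<delta>_def)
  qed
  have int: "integrable M (\<lambda>\<omega>. of_bool (?Q \<omega>) * X q \<omega>)"
    by (rule intq) (auto simp: of_bool_def)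
  have nonneg: "0 \<le> of_bool (?Q \<omega>) * X q \<omega>" for \<omega> by (auto simp: escapes_def)
  have "(\<lambda>m. 2 * (1 / real (Suc m))) \<longlonglongrightarrow> 2 * 0"
    by (intro tendsto_mult tendsto_const LIMSEQ_Suc lim_const_over_n)
  then have "(\<integral>\<omega>. of_bool (?Q \<omega>) * X q \<omega> \<partial>M) \<le> 0"
    using bound by (intro LIMSEQ_le_const) auto
  moreover have "0 \<le> (\<integral>\<omega>. of_bool (?Q \<omega>) * X q \<omega> \<partial>M)"
    using nonneg by (intro integral_nonneg_AE) auto
  ultimately have "(\<integral>\<omega>. of_bool (?Q \<omega>) * X q \<omega> \<partial>M) = 0" by simp
  then have "AE \<omega> in M. of_bool (?Q \<omega>) * X q \<omega> = 0"
    using integral_nonneg_eq_0_iff_AE[OF int] nonneg by auto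
  then show ?thesis
    by (rule AE_mp) (auto simp: escapes_def)
qed

end

end

section \<open>Isolated zeros of continuous functions\<close>

text \<open>To the left of \<open>t\<close> the function has a constant sign, to the right it is positive.  The grid point at
  or just after \<open>t\<close> has a value in \<open>[0, \<delta>]\<close> once the grid is fine enough, and the sequence remains active from
  there.\<close>

lemma isolated_zero_escapes:
  fixes f :: "real \<Rightarrow> real"
  assumes cont: "continuous_on {p..q} f" and t: "p \<le> t" "t < q" "f t = 0"
    and ne: "\<And>s. s \<in> {p..q} \<Longrightarrow> s \<noteq> t \<Longrightarrow> f s \<noteq> 0" and pos: "0 < f q"
  shows "escapes f p q"
proof -
  have pq: "p < q" using t by simp
  have sign: "f u > 0" if uv: "p \<le> u" "u \<le> q" "p \<le> v" "v \<le> q" "f v > 0" "u \<noteq> t" "v \<noteq> t"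
    "u < t \<longleftrightarrow> v < t" for u v
  proof (rule ccontr)
    assume neg: "\<not> f u > 0"
    have "\<exists>s\<in>closed_segment u v. f s = 0"
    proof -
      have "continuous_on (closed_segment u v) f"
        using uv by (intro continuous_on_subset[OF cont]) (auto simp: closed_segment_eq_real_ivl)
      then have "connected (f ` closed_segment u v)" 
        by (intro connected_continuous_image) auto
      moreover have "f u \<in> f ` closed_segment u v" "f v \<in> f ` closed_segment u v" by auto
      ultimately have "0 \<in> f ` closed_segment u v"
        using neg uv connected_contains_Icc[of "f ` closed_segment u v" "f u" "f v"] by auto
      then show ?thesis by auto
    qed
    then show False using uv ne by (auto simp: closed_segment_eq_real_ivl split: if_splits)
  qed
  have right: "0 \<le> f s" if "t \<le> s" "s \<le> q" for s
    using sign[of s q] that t pos by (cases "s = t") auto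
  have left: "(\<forall>s. p \<le> s \<and> s < t \<longrightarrow> f s < 0) \<or> (\<forall>s. p \<le> s \<and> s < t \<longrightarrow> 0 \<le> f s)"
  proof (cases "\<exists>v. p \<le> v \<and> v < t \<and> f v > 0")
    case True
    then obtain v where "p \<le> v" "v < t" "f v > 0" by blast
    then have "f s > 0" if "p \<le> s" "s < t" for s using sign[of s v] that t by auto
    then show ?thesis by (meson less_imp_le)
  next
    case False
    then have "f s < 0" if "p \<le> s" "s < t" for s
      using ne[of s] that t by force
    then show ?thesis by blast
  qed
  have "\<exists>N0. \<forall>N\<ge>N0. active (\<lambda>k. f (grid p q (Suc N) k)) \<delta> (Suc N)" if \<delta>: "0 < \<delta>" for \<delta>
  proof -
    obtain d where d: "0 < d" "\<And>s. s \<in> {p..q} \<Longrightarrow> dist s t < d \<Longrightarrow> dist (f s) (f t) < \<delta>"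
      using cont t \<delta> unfolding continuous_on_iff by (metis atLeastAtMost_iff less_imp_le)
    have "(\<lambda>N. (q - p) / real (Suc N)) \<longlonglongrightarrow> 0"
      by (intro LIMSEQ_Suc lim_const_over_n)
    then have "eventually (\<lambda>N. (q - p) / real (Suc N) < d) sequentially"
      using d(1) by (rule order_tendstoD)
    then have "eventually (\<lambda>N. active (\<lambda>k. f (grid p q (Suc N) k)) \<delta> (Suc N)) sequentially"
    proof (rule eventually_mono)
      fix N assume N: "(q - p) / real (Suc N) < d"
      note gp = grid_props[OF pq, of "Suc N", simplified]
      let ?g = "grid p q (Suc N)"
      define k where "k = (LEAST k. t \<le> ?g k)"
      have last: "t \<le> ?g (Suc N)" using gp(1) t by simp
      have k: "t \<le> ?g k" unfolding k_def by (rule LeastI[of "\<lambda>k. t \<le> ?g k", OF last])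
      have kN: "k \<le> Suc N" unfolding k_def by (rule Least_le[of "\<lambda>k. t \<le> ?g k", OF last])
      have less: "?g j < t" if "j < k" for j
        using not_less_Least[of j "\<lambda>k. t \<le> ?g k"] that by (auto simp: k_def)
      have near: "?g k < t + d"
      proof (cases k)
        case 0
        then show ?thesis using t d(1) by (simp add: grid_def)
      next
        case (Suc j)
        then show ?thesis using less[of j] gp(4)[of j] N by simp
      qed
      show "active (\<lambda>k. f (?g k)) \<delta> (Suc N)"
      proof (rule active_from_hit[OF _ kN])
        have "dist (f (?g k)) (f t) < \<delta>"
          using near k kN gp(3,5)[of k] by (intro d(2)) (auto simp: dist_real_def)
        then show "f (?g k) \<le> \<delta>" using t by (simp add: dist_real_def)
        show "(\<forall>j<k. f (?g j) < 0) \<or> (\<forall>j<k. 0 \<le> f (?g j))"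
          using left less gp(3) by blast
        show "0 \<le> f (?g j)" if "k \<le> j" "j \<le> Suc N" for j
          using right[of "?g j"] gp(2)[OF that(1)] gp(5)[OF that(2)] k by linarith
      qed
    qed
    then show ?thesis by (simp add: eventually_sequentially)
  qed
  then show ?thesis unfolding escapes_def using pos by simp
qed

section \<open>The canonical filtration\<close>

lemma diffs_nth: "i < length x \<Longrightarrow> diffs x ! i = (if i = 0 then x ! 0 else x ! i - x ! (i - 1))"
  by (simp add: diffs_def)

lemma sum_diffs: "i < length x \<Longrightarrow> (\<Sum>j\<le>i. diffs x ! j) = x ! i"
  by (induction i) (simp_all add: diffs_nth)

text \<open>Continuous approximations from below of the indicator function of \<open>{c<..}\<close>.\<close>

definition ramp :: "nat \<Rightarrow> real \<Rightarrow> real \<Rightarrow> real" where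
  "ramp k c z = max 0 (min 1 (real k * (z - c)))"

lemma ramp_bounds: "0 \<le> ramp k c z" "ramp k c z \<le> 1" "\<bar>ramp k c z\<bar> \<le> 1"
  by (auto simp: ramp_def)

lemma ramp_lipschitz: "\<bar>ramp k c z - ramp k c z'\<bar> \<le> real k * \<bar>z - z'\<bar>"
proof -
  have clip: "\<bar>max 0 (min 1 u) - max 0 (min 1 v)\<bar> \<le> \<bar>u - v\<bar>" for u v :: real
    by (auto simp: max_def min_def abs_if)
  have "\<bar>ramp k c z - ramp k c z'\<bar> \<le> \<bar>real k * (z - c) - real k * (z' - c)\<bar>"
    unfolding ramp_def by (rule clip)
  also have "real k * (z - c) - real k * (z' - c) = real k * (z - z')" by (simp add: algebra_simps)
  also have "\<bar>real k * (z - z')\<bar> = real k * \<bar>z - z'\<bar>" by (simp add: abs_mult)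
  finally show ?thesis .
qed

lemma ramp_tendsto: "(\<lambda>k. ramp k c z) \<longlonglongrightarrow> of_bool (c < z)"
proof (cases "c < z")
  case True
  have "eventually (\<lambda>k. ramp k c z = 1) sequentially"
  proof (rule eventually_mono[OF eventually_ge_at_top[of "nat \<lceil>1 / (z - c)\<rceil>"]])
    fix k assume "nat \<lceil>1 / (z - c)\<rceil> \<le> k"
    then have "1 / (z - c) \<le> real k" by linarith
    then show "ramp k c z = 1" using True by (auto simp: ramp_def field_simps)
  qed
  then show ?thesis using True by (simp add: tendsto_eventually)
next
  case False
  have "ramp k c z = 0" for k
  proof -
    have "real k * (z - c) \<le> 0" using False by (intro mult_nonneg_nonpos) auto
    then show ?thesis unfolding ramp_def by linarith
  qed
  then show ?thesis using False by simp
qed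

lemma ramp_measurable [measurable]: "ramp k c \<in> borel_measurable borel"
  unfolding ramp_def by measurable

lemma space_path_algebra: "space path_algebra = paths"
  unfolding path_algebra_def by (rule space_measure_of) auto

lemma B_measurable:
  assumes "0 \<le> t"
  shows "B t \<in> borel_measurable path_algebra"
proof (rule measurableI)
  fix A :: "real set" assume "A \<in> sets borel"
  moreover have "B t -` A \<inter> paths = {\<omega> \<in> paths. B t \<omega> \<in> A}" by auto
  ultimately show "B t -` A \<inter> space path_algebra \<in> sets path_algebra"
    unfolding space_path_algebra unfolding path_algebra_def
    using assms by (subst sets_measure_of) (auto intro!: sigma_sets.Basic)
qed simp

definition past :: "real \<Rightarrow> (real \<Rightarrow> real) measure" where
  "past s = sigma paths {{\<omega> \<in> paths. B u \<omega> \<in> A} | u A. 0 \<le> u \<and> u \<le> s \<and> A \<in> sets borel}"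

lemma space_past: "space (past s) = paths"
  unfolding past_def by (rule space_measure_of) auto

lemma sets_past: "sets (past s) =
    sigma_sets paths {{\<omega> \<in> paths. B u \<omega> \<in> A} | u A. 0 \<le> u \<and> u \<le> s \<and> A \<in> sets borel}"
  unfolding past_def by (rule sets_measure_of) auto

lemma sets_past_subset: "sets (past s) \<subseteq> sets path_algebra"
  unfolding sets_past unfolding path_algebra_def
  by (subst sets_measure_of) (auto intro!: sigma_sets_mono')

lemma B_measurable_past:
  assumes "0 \<le> u" "u \<le> s"
  shows "B u \<in> borel_measurable (past s)"
proof (rule measurableI)
  fix A :: "real set" assume "A \<in> sets borel"
  moreover have "B u -` A \<inter> paths = {\<omega> \<in> paths. B u \<omega> \<in> A}" by auto
  ultimately show "B u -` A \<inter> space (past s) \<in> sets (past s)"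
    unfolding space_past sets_past using assms by (auto intro!: sigma_sets.Basic)
qed simp

text \<open>Sets given by finitely many conditions \<open>c < B u\<close>; indexing them by a finite set of pairs
  \<open>(u, c)\<close> turns intersections into unions of index sets.\<close>

definition past_boxes :: "real \<Rightarrow> (real \<Rightarrow> real) set set" where
  "past_boxes s = {{\<omega> \<in> paths. \<forall>(u, c)\<in>J. c < B u \<omega>} | J. finite J \<and> fst ` J \<subseteq> {0..s}}"

lemma Int_stable_past_boxes: "Int_stable (past_boxes s)"
proof (rule Int_stableI)
  fix A A' assume "A \<in> past_boxes s" "A' \<in> past_boxes s"
  then obtain J J' where "A = {\<omega> \<in> paths. \<forall>(u, c)\<in>J. c < B u \<omega>}" "finite J" "fst ` J \<subseteq> {0..s}"
    "A' = {\<omega> \<in> paths. \<forall>(u, c)\<in>J'. c < B u \<omega>}" "finite J'" "fst ` J' \<subseteq> {0..s}"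
    unfolding past_boxes_def by blast
  then show "A \<inter> A' \<in> past_boxes s"
    unfolding past_boxes_def by (intro CollectI exI[of _ "J \<union> J'"]) auto
qed

lemma sets_past_boxes: "sets (past s) = sigma_sets paths (past_boxes s)"
proof
  have sub: "past_boxes s \<subseteq> Pow paths" by (auto simp: past_boxes_def)
  let ?S = "sigma paths (past_boxes s)"
  have S: "sets ?S = sigma_sets paths (past_boxes s)" "space ?S = paths"
    using sub by (simp_all add: sets_measure_of space_measure_of)
  have "{\<omega> \<in> paths. B u \<omega> \<in> A} \<in> sigma_sets paths (past_boxes s)"
    if u: "0 \<le> u" "u \<le> s" and A: "A \<in> sets borel" for u A
  proof -
    have "B u \<in> borel_measurable ?S"
    proof (rule borel_measurableI_greater)
      fix c
      have "{\<omega> \<in> paths. c < B u \<omega>} \<in> past_boxes s"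
        unfolding past_boxes_def using u by (intro CollectI exI[of _ "{(u, c)}"]) auto
      then show "{\<omega> \<in> space ?S. c < B u \<omega>} \<in> sets ?S" unfolding S by (rule sigma_sets.Basic)
    qed
    from measurable_sets[OF this A] show ?thesis
      unfolding S by (simp add: vimage_def Int_def conj_commute)
  qed
  then show "sets (past s) \<subseteq> sigma_sets paths (past_boxes s)"
    unfolding sets_past by (intro sigma_sets_mono) auto
  show "sigma_sets paths (past_boxes s) \<subseteq> sets (past s)"
  proof (rule sets.sigma_sets_subset[of _ "past s", unfolded space_past])
    show "past_boxes s \<subseteq> sets (past s)"
    proof
      fix A assume "A \<in> past_boxes s"
      then obtain J where J: "A = {\<omega> \<in> paths. \<forall>(u, c)\<in>J. c < B u \<omega>}" "finite J" "fst ` J \<subseteq> {0..s}"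
        unfolding past_boxes_def by blast
      have "Measurable.pred (past s) (\<lambda>\<omega>. case j of (u, c) \<Rightarrow> c < B u \<omega>)" if "j \<in> J" for j
      proof -
        obtain u c where j: "j = (u, c)" by fastforce
        then have [measurable]: "B u \<in> borel_measurable (past s)"
          using that J(3) by (intro B_measurable_past) force+
        show ?thesis unfolding j by simp
      qed
      then have "Measurable.pred (past s) (\<lambda>\<omega>. \<forall>j\<in>J. case j of (u, c) \<Rightarrow> c < B u \<omega>)"
        by (rule pred_intros_finite(3)[OF J(2)])
      then show "A \<in> sets (past s)" unfolding J(1) by (simp add: pred_def space_past)
    qed
  qed
qed

section \<open>The coordinate process is a martingale under every law\<close>

locale G_brownian_law = sublinear_expectation_space H E
  for H :: "('w \<Rightarrow> real) set" and E +
  fixes G :: "real \<Rightarrow> real" and \<xi> :: "nat \<Rightarrow> 'w \<Rightarrow> real"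
    and Ehat :: "((real \<Rightarrow> real) \<Rightarrow> real) \<Rightarrow> real"
    and \<P> :: "(real \<Rightarrow> real) measure set" and P :: "(real \<Rightarrow> real) measure"
  assumes normal: "G_normal H E G (\<xi> i)"
    and indep: "indep_from E (\<xi> (Suc i)) (map \<xi> [0..<Suc i])"
    and expectation: "G_expectation_on_L_ip E \<xi> Ehat"
    and repr: "represents \<P> Ehat"
    and P: "P \<in> \<P>"
begin

lemma prob_space_P: "prob_space P" and sets_P [measurable_cong]: "sets P = sets path_algebra"
  using repr P by (auto simp: represents_def path_probs_def)

lemma space_P: "space P = paths"
  using sets_eq_imp_space_eq[OF sets_P] by (simp add: space_path_algebra)

lemma B_measurable_P: "0 \<le> t \<Longrightarrow> B t \<in> borel_measurable P"
  using B_measurable sets_P by (simp cong: measurable_cong_sets)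

sublocale P: prob_space P by (rule prob_space_P)

lemma \<xi>_mem: "\<xi> i \<in> H" and \<xi>_square_mem: "(\<lambda>w. (\<xi> i w)\<^sup>2) \<in> H"
  and \<xi>_variance: "E (\<lambda>w. (\<xi> i w)\<^sup>2) = 2 * G 1"
proof -
  have n: "\<xi> i \<in> H" "(\<lambda>w. (\<xi> i w)\<^sup>2) \<in> H" "\<forall>\<alpha>. G \<alpha> = 1/2 * E (\<lambda>w. \<alpha> * (\<xi> i w)\<^sup>2)"
    using normal[of i] unfolding G_normal_def by blast+
  then show "\<xi> i \<in> H" "(\<lambda>w. (\<xi> i w)\<^sup>2) \<in> H" by blast+
  show "E (\<lambda>w. (\<xi> i w)\<^sup>2) = 2 * G 1" using n(3)[rule_format, of 1] by simp
qed

text \<open>A measurable cylinder function is its own constant approximating sequence, so the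
  representation applies to it; boundedness makes the supremum a genuine upper bound.\<close>

lemma integral_cylinder_le:
  assumes ts: "time_grid ts" and \<phi>: "CbLip (length ts) \<phi>"
    and meas: "cylinder_fun \<phi> ts \<in> borel_measurable path_algebra"
  shows "(\<integral>\<omega>. cylinder_fun \<phi> ts \<omega> \<partial>P) \<le> E (\<lambda>w. \<phi> (map (\<lambda>i. sqrt (diffs ts ! i) * \<xi> i w) [0..<length ts]))"
proof -
  let ?Z = "cylinder_fun \<phi> ts"
  obtain C where C: "\<And>x. length x = length ts \<Longrightarrow> \<bar>\<phi> x\<bar> \<le> C" using \<phi> unfolding CbLip_def by blast
  have Z: "?Z \<in> L1_G \<P>"
    unfolding L1_G_def
  proof (intro CollectI conjI meas exI[of _ "\<lambda>_. ?Z"] allI)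
    show "?Z \<in> L_ip" unfolding L_ip_def using ts \<phi> by blast
    have "\<P> \<noteq> {}" using P by blast
    then show "(\<lambda>n. SUP P\<in>\<P>. \<integral>\<^sup>+ \<omega>. ennreal \<bar>?Z \<omega> - ?Z \<omega>\<bar> \<partial>P) \<longlonglongrightarrow> 0" by simp
  qed
  have "(\<integral>\<omega>. ?Z \<omega> \<partial>P) \<le> (SUP P\<in>\<P>. \<integral>\<omega>. ?Z \<omega> \<partial>P)"
  proof (rule cSUP_upper[OF P])
    have "(\<integral>\<omega>. ?Z \<omega> \<partial>Q) \<le> \<bar>C\<bar>" if "Q \<in> \<P>" for Q
    proof -
      have "Q \<in> path_probs" using repr that by (auto simp: represents_def)
      then interpret Q: prob_space Q by (simp add: path_probs_def)
      have "?Z \<omega> \<le> \<bar>C\<bar>" for \<omega>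
        using C[of "diffs (map (\<lambda>t. B t \<omega>) ts)"] by (auto simp: cylinder_fun_def diffs_def)
      then show ?thesis
        by (cases "integrable Q ?Z")
          (auto simp: not_integrable_integral_eq intro: Q.integral_le_const)
    qed
    then show "bdd_above ((\<lambda>P. \<integral>\<omega>. ?Z \<omega> \<partial>P) ` \<P>)" by (auto intro!: bdd_aboveI2)
  qed
  also have "\<dots> = Ehat ?Z" using repr Z unfolding represents_def by simp
  also have "\<dots> = E (\<lambda>w. \<phi> (map (\<lambda>i. sqrt (diffs ts ! i) * \<xi> i w) [0..<length ts]))"
    using expectation ts \<phi> unfolding G_expectation_on_L_ip_def by blast
  finally show ?thesis .
qed

text \<open>The integrals of the truncations of \<open>\<bar>B t\<bar>\<close> are at most the sublinear expectation of \<open>1 + t X\<^sup>2\<close> for a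
  \<open>G\<close>-normal \<open>X\<close>, uniformly in the height of the truncation; monotone convergence does the rest.\<close>

lemma integrable_B:
  assumes t: "0 \<le> t"
  shows "integrable P (B t)"
proof -
  note [measurable] = B_measurable_P[OF t]
  define f where "f m \<omega> = trunc (real m) \<bar>B t \<omega>\<bar>" for m :: nat and \<omega>
  have meas: "f m \<in> borel_measurable path_algebra" for m
    using B_measurable[OF t] unfolding f_def by measurable
  then have measP: "f m \<in> borel_measurable P" for m
    using sets_P by (simp cong: measurable_cong_sets)
  have int: "integrable P (f m)" for m
    using measP by (intro P.integrable_const_bound[of _ "real m"]) (auto simp: f_def abs_trunc_le)
  have bound: "(\<integral>\<omega>. f m \<omega> \<partial>P) \<le> 1 + t * (2 * G 1)" for m
  proof -
    let ?\<phi> = "\<lambda>x :: real list. trunc (real m) \<bar>1 * x ! 0\<bar>"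
    have eq: "cylinder_fun ?\<phi> [t] = f m" by (auto simp: cylinder_fun_def diffs_def f_def)
    have lip: "CbLip (length [t]) ?\<phi>"
      by (rule CbLip_coordinate[where C = "real m" and L = 1])
        (auto simp: abs_trunc_le intro!: order_trans[OF trunc_lipschitz])
    have "(\<integral>\<omega>. f m \<omega> \<partial>P) \<le> E (\<lambda>w. trunc (real m) \<bar>sqrt t * \<xi> 0 w\<bar>)"
      using integral_cylinder_le[OF _ lip] t meas[of m] unfolding eq
      by (simp add: time_grid_def diffs_def)
    also have "\<dots> \<le> E (\<lambda>w. 1 + t * (\<xi> 0 w)\<^sup>2)"
    proof (rule monotone)
      show "(\<lambda>w. trunc (real m) \<bar>sqrt t * \<xi> 0 w\<bar>) \<in> H"
        by (rule lipschitz_mem[OF scale_mem[OF \<xi>_mem], where C = "real m" and L = 1 and g = "\<lambda>z. trunc (real m) \<bar>z\<bar>"])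
          (auto simp: abs_trunc_le intro!: order_trans[OF trunc_lipschitz])
      show "(\<lambda>w. 1 + t * (\<xi> 0 w)\<^sup>2) \<in> H" by (intro add_mem const_mem scale_mem \<xi>_square_mem)
      show "trunc (real m) \<bar>sqrt t * \<xi> 0 w\<bar> \<le> 1 + t * (\<xi> 0 w)\<^sup>2" for w
      proof -
        have "trunc (real m) \<bar>sqrt t * \<xi> 0 w\<bar> \<le> \<bar>sqrt t * \<xi> 0 w\<bar>"
          using abs_trunc_le_arg[of "real m" "\<bar>sqrt t * \<xi> 0 w\<bar>"] by simp
        also have "\<dots> \<le> 1 + (sqrt t * \<xi> 0 w)\<^sup>2"
        proof -
          have "y \<le> 1 + y\<^sup>2" for y :: real
          proof -
            have "y\<^sup>2 - y + 1 / 4 = (y - 1 / 2)\<^sup>2" by (simp add: power2_eq_square algebra_simps)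
            then have "0 \<le> y\<^sup>2 - y + 1 / 4" by simp
            then show ?thesis by linarith
          qed
          from this[of "\<bar>sqrt t * \<xi> 0 w\<bar>"] show ?thesis by (simp only: power2_abs)
        qed
        finally show ?thesis using t by (simp add: power_mult_distrib)
      qed
    qed
    also have "\<dots> = 1 + t * (2 * G 1)"
      using add_const[OF scale_mem[OF \<xi>_square_mem], of 1 t 0] pos_homogeneous[OF \<xi>_square_mem t]
      by (simp add: \<xi>_variance)
    finally show ?thesis .
  qed
  have mono: "f m \<omega> \<le> f n \<omega>" if "m \<le> n" for m n \<omega> using that by (auto simp: f_def trunc_def)
  have "incseq (\<lambda>m. \<integral>\<omega>. f m \<omega> \<partial>P)" by (intro incseq_SucI integral_mono int mono) simp
  then obtain L where L: "(\<lambda>m. \<integral>\<omega>. f m \<omega> \<partial>P) \<longlonglongrightarrow> L"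
    using bound incseq_convergent by blast
  have "integrable P (\<lambda>\<omega>. \<bar>B t \<omega>\<bar>)"
  proof (rule integrable_monotone_convergence[OF int _ _ L])
    show "AE \<omega> in P. mono (\<lambda>m. f m \<omega>)" by (intro AE_I2 monoI mono)
    show "AE \<omega> in P. (\<lambda>m. f m \<omega>) \<longlonglongrightarrow> \<bar>B t \<omega>\<bar>"
      unfolding f_def by (intro AE_I2 tendsto_eventually trunc_eventually_id)
  qed measurable
  then show ?thesis by (simp add: integrable_abs_iff)
qed

text \<open>The product of ramps and \<open>h\<close> of the increment is a cylinder function over the times in \<open>J\<close>, \<open>s\<close>
  and \<open>t\<close>.  Independence of the last increment factors its sublinear expectation, since the
  product of ramps is nonnegative, and the factor from the past lies in \<open>[0, 1]\<close>.  Which variable \<open>\<xi> n\<close> appears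
  depends on the number of times, so it is existentially quantified.\<close>

lemma past_times_increment_le:
  assumes J: "finite J" "fst ` J \<subseteq> {0..s}" and st: "0 \<le> s" "s < t"
    and h: "\<And>z. \<bar>h z\<bar> \<le> C" "\<And>z z'. \<bar>h z - h z'\<bar> \<le> L * \<bar>z - z'\<bar>"
    and h_meas: "h \<in> borel_measurable borel"
  shows "\<exists>n. (\<integral>\<omega>. (\<Prod>(u, c)\<in>J. ramp k c (B u \<omega>)) * h (B t \<omega> - B s \<omega>) \<partial>P)
    \<le> \<bar>E (\<lambda>w. h (sqrt (t - s) * \<xi> n w))\<bar>"
proof -
  define T where "T = insert s (fst ` J)"
  define l where "l = sorted_list_of_set T"
  define n where "n = length l"
  define ts where "ts = l @ [t]"
  have T: "finite T" "T \<subseteq> {0..s}" using J st by (auto simp: T_def)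
  have l: "set l = T" "sorted_wrt (<) l" using T(1) by (auto simp: l_def)
  have n: "0 < n" using l(1) by (auto simp: n_def T_def)
  have len: "length ts = Suc n" by (simp add: ts_def n_def)
  have tsn: "ts ! n = t" by (simp add: ts_def n_def)
  have sorted: "sorted_wrt (<) ts"
    using l T(2) st by (auto simp: ts_def sorted_wrt_append)
  have grid: "time_grid ts"
  proof -
    have "hd ts \<in> set l" using n by (auto simp: ts_def n_def)
    then have "0 \<le> hd ts" using l(1) T(2) by auto
    then show ?thesis using sorted by (auto simp: time_grid_def ts_def)
  qed
  have index: "\<exists>i<n. ts ! i = u \<and> {j. j < Suc n \<and> ts ! j \<le> u} = {..i}" if u: "u \<in> T" for u
  proof -
    obtain i where i: "i < n" "ts ! i = u"
      using u l(1) by (auto simp: in_set_conv_nth ts_def nth_append n_def)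
    have "ts ! j \<le> u \<longleftrightarrow> j \<le> i" if "j < Suc n" for j
      using sorted_wrt_nth_less[OF sorted, of i j] sorted_wrt_nth_less[OF sorted, of j i] that i len
      by (cases i j rule: linorder_cases) auto
    then show ?thesis using i by (intro exI[of _ i]) auto
  qed
  have ts_pred: "ts ! (n - 1) = s"
  proof -
    obtain i where i: "i < n" "ts ! i = s" "{j. j < Suc n \<and> ts ! j \<le> s} = {..i}"
      using index[of s] by (auto simp: T_def)
    have "ts ! (n - 1) \<in> T" using n l(1) by (auto simp: ts_def nth_append n_def)
    then have "n - 1 \<in> {..i}" unfolding i(3)[symmetric] using T(2) n by auto
    then show ?thesis using i by (metis Suc_pred' atMost_iff le_antisym less_Suc_eq_le n)
  qed
  have partial_sum: "(\<Sum>j<Suc n. of_bool (ts ! j \<le> u) * diffs (map (\<lambda>t. B t \<omega>) ts) ! j) = B u \<omega>"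
    if u: "u \<in> T" for u \<omega>
  proof -
    let ?x = "map (\<lambda>t. B t \<omega>) ts"
    obtain i where i: "i < n" "ts ! i = u" "{j. j < Suc n \<and> ts ! j \<le> u} = {..i}"
      using index[OF u] by blast
    have "(\<Sum>j<Suc n. of_bool (ts ! j \<le> u) * diffs ?x ! j) = (\<Sum>j\<in>{j. j < Suc n \<and> ts ! j \<le> u}. diffs ?x ! j)"
      by (rule sum.mono_neutral_cong_right) auto
    also have "\<dots> = ?x ! i" unfolding i(3) using i(1) len by (intro sum_diffs) simp
    finally show ?thesis using i len by simp
  qed
  \<comment> \<open>The factor from the past, as a function of increments that are scaled by \<open>b\<close>: \<open>b = 1\<close> for the
    increments of the path, \<open>b = d\<close> for standard \<open>G\<close>-normal variables.\<close>
  define V where "V b x = (\<Prod>(u, c)\<in>J. ramp k c (\<Sum>j<Suc n. of_bool (ts ! j \<le> u) * b j * x ! j))"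
    for b :: "nat \<Rightarrow> real" and x :: "real list"
  have V01: "0 \<le> V b x" "V b x \<le> 1" for b x
    unfolding V_def by (auto intro!: prod_nonneg prod_le_1 simp: ramp_bounds split: prod.splits)
  have V_lip: "CbLip (Suc n) (V b)" for b
    unfolding V_def
  proof (intro CbLip_prod)
    fix j assume "j \<in> J"
    show "CbLip (Suc n) (\<lambda>x. case j of (u, c) \<Rightarrow> ramp k c (\<Sum>j<Suc n. of_bool (ts ! j \<le> u) * b j * x ! j))"
      unfolding case_prod_beta
      by (rule CbLip_ridge[where C = 1 and L = "real k"]) (auto simp: ramp_bounds ramp_lipschitz)
  qed
  have V_last: "V b (y @ [z]) = V b (y @ [z'])" if "length y = n" for b y z z'
  proof -
    have "\<not> ts ! n \<le> fst j" if "j \<in> J" for j using that J(2) st unfolding tsn by force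
    then show ?thesis unfolding V_def case_prod_beta using that
      by (intro prod.cong refl) (simp add: nth_append)
  qed
  have h_lip: "CbLip (Suc n) (\<lambda>x. h (r * x ! n))" for r
    by (rule CbLip_coordinate[OF h]) simp
  define \<phi> where "\<phi> x = V (\<lambda>_. 1) x * h (1 * x ! n)" for x
  define d where "d j = sqrt (diffs ts ! j)" for j
  have dn: "d n = sqrt (t - s)" using n len ts_pred by (simp add: d_def diffs_nth tsn)
  have cyl: "cylinder_fun \<phi> ts = (\<lambda>\<omega>. (\<Prod>(u, c)\<in>J. ramp k c (B u \<omega>)) * h (B t \<omega> - B s \<omega>))"
  proof
    fix \<omega>
    have "V (\<lambda>_. 1) (diffs (map (\<lambda>t. B t \<omega>) ts)) = (\<Prod>(u, c)\<in>J. ramp k c (B u \<omega>))"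
      unfolding V_def case_prod_beta
    proof (intro prod.cong refl)
      fix j assume "j \<in> J"
      then have "fst j \<in> T" by (simp add: T_def)
      then show "ramp k (snd j) (\<Sum>i<Suc n. of_bool (ts ! i \<le> fst j) * 1 * diffs (map (\<lambda>t. B t \<omega>) ts) ! i)
          = ramp k (snd j) (B (fst j) \<omega>)"
        using partial_sum[of "fst j" \<omega>] by (simp only: mult_1_right)
    qed
    moreover have "diffs (map (\<lambda>t. B t \<omega>) ts) ! n = B t \<omega> - B s \<omega>"
      using n len ts_pred by (simp add: diffs_nth tsn)
    ultimately show "cylinder_fun \<phi> ts \<omega> = (\<Prod>(u, c)\<in>J. ramp k c (B u \<omega>)) * h (B t \<omega> - B s \<omega>)"
      by (simp add: cylinder_fun_def \<phi>_def)
  qed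
  have meas: "cylinder_fun \<phi> ts \<in> borel_measurable path_algebra"
  proof -
    have [measurable]: "B t \<in> borel_measurable path_algebra" "B s \<in> borel_measurable path_algebra"
      using st by (auto intro: B_measurable)
    have "(\<lambda>\<omega>. \<Prod>j\<in>J. ramp k (snd j) (B (fst j) \<omega>)) \<in> borel_measurable path_algebra"
    proof (rule borel_measurable_prod)
      fix j assume "j \<in> J"
      then have [measurable]: "B (fst j) \<in> borel_measurable path_algebra"
        using J(2) by (intro B_measurable) force
      show "(\<lambda>\<omega>. ramp k (snd j) (B (fst j) \<omega>)) \<in> borel_measurable path_algebra" by measurable
    qed
    then show ?thesis unfolding cyl case_prod_beta using h_meas by measurable
  qed
  have "(\<integral>\<omega>. (\<Prod>(u, c)\<in>J. ramp k c (B u \<omega>)) * h (B t \<omega> - B s \<omega>) \<partial>P)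
      \<le> E (\<lambda>w. \<phi> (map (\<lambda>i. d i * \<xi> i w) [0..<Suc n]))"
    using integral_cylinder_le[OF grid _ meas, unfolded len cyl] CbLip_mult[OF V_lip h_lip]
    unfolding \<phi>_def d_def by blast
  also have "\<dots> = E (\<lambda>w. V d (eval_vec (map \<xi> [0..<n]) w @ [\<xi> n w]) * h (d n * (eval_vec (map \<xi> [0..<n]) w @ [\<xi> n w]) ! n))"
  proof -
    have "\<phi> (map (\<lambda>i. d i * \<xi> i w) [0..<Suc n])
      = V d (eval_vec (map \<xi> [0..<n]) w @ [\<xi> n w]) * h (d n * (eval_vec (map \<xi> [0..<n]) w @ [\<xi> n w]) ! n)" for w
    proof -
      have e: "eval_vec (map \<xi> [0..<n]) w @ [\<xi> n w] = map (\<lambda>i. \<xi> i w) [0..<Suc n]"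
        by (simp add: eval_vec_def comp_def)
      have nth: "map f [0..<Suc n] ! j = f j" if "j < Suc n" for f :: "nat \<Rightarrow> real" and j
        using that by (simp del: upt_Suc)
      show ?thesis
        unfolding e \<phi>_def V_def by (simp add: nth mult.assoc del: upt_Suc sum.lessThan_Suc cong: sum.cong_simp)
    qed
    then show ?thesis by simp
  qed
  also have "\<dots> = E (\<lambda>w. E (\<lambda>w'. V d (eval_vec (map \<xi> [0..<n]) w @ [\<xi> n w'])
      * h (d n * (eval_vec (map \<xi> [0..<n]) w @ [\<xi> n w']) ! n)))"
  proof -
    obtain i where i: "n = Suc i" using n gr0_implies_Suc by blast
    have "CbLip (Suc (length (map \<xi> [0..<n]))) (\<lambda>x. V d x * h (d n * x ! n))"
      using CbLip_mult[OF V_lip h_lip] by simp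
    then show ?thesis using indep[of i] unfolding indep_from_def i by blast
  qed
  also have "\<dots> \<le> \<bar>E (\<lambda>w. h (d n * \<xi> n w))\<bar>"
  proof -
    let ?e = "E (\<lambda>w. h (d n * \<xi> n w))"
    have h_mem: "(\<lambda>w. h (d n * \<xi> n w)) \<in> H"
      by (rule lipschitz_mem[OF scale_mem[OF \<xi>_mem] h])
    have len_e: "length (eval_vec (map \<xi> [0..<n]) w) = n" for w by (simp add: eval_vec_def)
    have inner: "E (\<lambda>w'. V d (eval_vec (map \<xi> [0..<n]) w @ [\<xi> n w'])
      * h (d n * (eval_vec (map \<xi> [0..<n]) w @ [\<xi> n w']) ! n)) = V d (eval_vec (map \<xi> [0..<n]) w @ [0]) * ?e" for w
    proof -
      have "V d (eval_vec (map \<xi> [0..<n]) w @ [\<xi> n w'])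
          * h (d n * (eval_vec (map \<xi> [0..<n]) w @ [\<xi> n w']) ! n)
        = V d (eval_vec (map \<xi> [0..<n]) w @ [0]) * h (d n * \<xi> n w')" for w'
        using V_last[OF len_e, of d w "\<xi> n w'" 0] len_e[of w] by (simp add: nth_append)
      then show ?thesis using pos_homogeneous[OF h_mem V01(1)] by simp
    qed
    have lip': "CbLip (length (map \<xi> [0..<n])) (\<lambda>y. V d (y @ [0]))"
    proof -
      obtain L' where L': "\<And>x y. length x = Suc n \<Longrightarrow> length y = Suc n \<Longrightarrow>
          \<bar>V d x - V d y\<bar> \<le> L' * L2_set (\<lambda>i. x ! i - y ! i) {..<Suc n}"
        using V_lip[of d] unfolding CbLip_def by blast
      have "\<bar>V d (x @ [0]) - V d (y @ [0])\<bar> \<le> L' * L2_set (\<lambda>i. x ! i - y ! i) {..<n}"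
        if "length x = n" "length y = n" for x y
        using L'[of "x @ [0]" "y @ [0]"] that by (simp add: L2_set_def nth_append)
      then have "\<exists>L. \<forall>x y. length x = n \<longrightarrow> length y = n \<longrightarrow>
          \<bar>V d (x @ [0]) - V d (y @ [0])\<bar> \<le> L * L2_set (\<lambda>i. x ! i - y ! i) {..<n}"
        by blast
      moreover have "\<bar>V d (x @ [0])\<bar> \<le> 1" for x using V01[of d "x @ [0]"] by simp
      ultimately show ?thesis unfolding CbLip_def by (auto intro: exI[of _ 1])
    qed
    have mem: "(\<lambda>w. V d (eval_vec (map \<xi> [0..<n]) w @ [0])) \<in> H"
      using \<xi>_mem by (intro comp_mem[OF _ lip']) auto
    have "E (\<lambda>w. V d (eval_vec (map \<xi> [0..<n]) w @ [0]) * ?e) \<le> E (\<lambda>_. \<bar>?e\<bar>)"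
    proof (rule monotone)
      show "(\<lambda>w. V d (eval_vec (map \<xi> [0..<n]) w @ [0]) * ?e) \<in> H"
        using scale_mem[OF mem, of ?e] by (simp add: mult.commute)
      show "V d (eval_vec (map \<xi> [0..<n]) w @ [0]) * ?e \<le> \<bar>?e\<bar>" for w
        using mult_mono[OF V01(2)[of d "eval_vec (map \<xi> [0..<n]) w @ [0]"] abs_ge_self[of ?e]]
          mult_mono[OF V01(2)[of d "eval_vec (map \<xi> [0..<n]) w @ [0]"] order_refl[of "\<bar>?e\<bar>"]]
          V01(1)[of d "eval_vec (map \<xi> [0..<n]) w @ [0]"]
        by (smt (verit) mult_left_mono abs_ge_zero abs_ge_self mult_1)
    qed (rule const_mem)
    then show ?thesis unfolding inner constant_preserving .
  qed
  finally show ?thesis unfolding dn by blast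
qed

text \<open>The one-sided bound is applied to the truncation and to its negative.  The truncated \<open>G\<close>-normal
  variable has expectation of order \<open>1 / m\<close>, since its mean is zero.\<close>

lemma truncated_increment_small:
  assumes J: "finite J" "fst ` J \<subseteq> {0..s}" and st: "0 \<le> s" "s < t" and m: "0 < m"
  shows "\<bar>\<integral>\<omega>. (\<Prod>(u, c)\<in>J. ramp k c (B u \<omega>)) * trunc m (B t \<omega> - B s \<omega>) \<partial>P\<bar> \<le> (t - s) * (2 * G 1) / m"
proof -
  have mean: "\<bar>E (\<lambda>w. trunc m (r * \<xi> n w))\<bar> \<le> r\<^sup>2 * (2 * G 1) / m" for r n
    using trunc_expectation[OF scale_mem[OF \<xi>_mem] _ m, of r n] scale_mem[OF \<xi>_square_mem, of "r\<^sup>2" n]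
      pos_homogeneous[OF \<xi>_square_mem, of "r\<^sup>2" n] G_normal_mean_zero[OF normal, of r n]
    by (simp add: power_mult_distrib \<xi>_variance)
  have sq: "(sqrt (t - s))\<^sup>2 = t - s" using st by simp
  obtain n where n: "(\<integral>\<omega>. (\<Prod>(u, c)\<in>J. ramp k c (B u \<omega>)) * trunc m (B t \<omega> - B s \<omega>) \<partial>P)
    \<le> \<bar>E (\<lambda>w. trunc m (sqrt (t - s) * \<xi> n w))\<bar>"
    using past_times_increment_le[OF J st, of "trunc m" m 1 k] m
    by (auto simp: abs_trunc_le trunc_lipschitz)
  have lip: "\<bar>trunc m (- z) - trunc m (- z')\<bar> \<le> 1 * \<bar>z - z'\<bar>" for z z'
    using trunc_lipschitz[of m "- z" "- z'"] by simp
  have "(\<lambda>z. trunc m (- z)) \<in> borel_measurable borel" by measurable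
  then obtain n' where n': "(\<integral>\<omega>. (\<Prod>(u, c)\<in>J. ramp k c (B u \<omega>)) * trunc m (- (B t \<omega> - B s \<omega>)) \<partial>P)
    \<le> \<bar>E (\<lambda>w. trunc m (- (sqrt (t - s) * \<xi> n' w)))\<bar>"
    using past_times_increment_le[OF J st _ lip, of m k] abs_trunc_le[of m] m by auto
  have "\<bar>E (\<lambda>w. trunc m (- (sqrt (t - s) * \<xi> n' w)))\<bar> \<le> (t - s) * (2 * G 1) / m"
    using mean[of "- sqrt (t - s)" n'] sq by simp
  moreover have "\<bar>E (\<lambda>w. trunc m (sqrt (t - s) * \<xi> n w))\<bar> \<le> (t - s) * (2 * G 1) / m"
    using mean[of "sqrt (t - s)" n] sq by simp
  moreover have "(\<integral>\<omega>. (\<Prod>(u, c)\<in>J. ramp k c (B u \<omega>)) * trunc m (- (B t \<omega> - B s \<omega>)) \<partial>P)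
    = - (\<integral>\<omega>. (\<Prod>(u, c)\<in>J. ramp k c (B u \<omega>)) * trunc m (B t \<omega> - B s \<omega>) \<partial>P)"
    using trunc_minus[of m] m by (simp del: minus_diff_eq)
  ultimately show ?thesis using n n' by linarith
qed

lemma past_box_fair:
  assumes st: "0 \<le> s" "s < t" and A: "A \<in> past_boxes s"
  shows "(\<integral>\<omega>. indicator A \<omega> * (B t \<omega> - B s \<omega>) \<partial>P) = 0"
proof -
  obtain J where J: "A = {\<omega> \<in> paths. \<forall>(u, c)\<in>J. c < B u \<omega>}" "finite J" "fst ` J \<subseteq> {0..s}"
    using A unfolding past_boxes_def by blast
  define \<Phi> where "\<Phi> k \<omega> = (\<Prod>(u, c)\<in>J. ramp k c (B u \<omega>))" for k \<omega>
  have t: "0 \<le> t" using st by simp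
  have int: "integrable P (\<lambda>\<omega>. B t \<omega> - B s \<omega>)" using integrable_B[OF t] integrable_B[OF st(1)] by simp
  have [measurable]: "B t \<in> borel_measurable P" "B s \<in> borel_measurable P"
    using st by (auto intro: B_measurable_P)
  have [measurable]: "\<Phi> k \<in> borel_measurable P" for k
    unfolding \<Phi>_def case_prod_beta
  proof (rule borel_measurable_prod)
    fix j assume "j \<in> J"
    then have [measurable]: "B (fst j) \<in> borel_measurable P"
      using J(3) by (intro B_measurable_P) force
    show "(\<lambda>\<omega>. ramp k (snd j) (B (fst j) \<omega>)) \<in> borel_measurable P" by measurable
  qed
  have \<Phi>: "0 \<le> \<Phi> k \<omega>" "\<Phi> k \<omega> \<le> 1" for k \<omega>
    unfolding \<Phi>_def by (auto intro!: prod_nonneg prod_le_1 simp: ramp_bounds split: prod.splits)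
  have \<Phi>_abs: "\<bar>\<Phi> k \<omega> * z\<bar> \<le> \<bar>z\<bar>" for k \<omega> z
    using \<Phi>[of k \<omega>] by (simp add: abs_mult mult_left_le_one_le)
  have zero: "(\<integral>\<omega>. \<Phi> k \<omega> * (B t \<omega> - B s \<omega>) \<partial>P) = 0" for k
  proof -
    have lim: "(\<lambda>m. \<integral>\<omega>. \<Phi> k \<omega> * trunc (real m) (B t \<omega> - B s \<omega>) \<partial>P)
      \<longlonglongrightarrow> (\<integral>\<omega>. \<Phi> k \<omega> * (B t \<omega> - B s \<omega>) \<partial>P)"
    proof (rule integral_dominated_convergence[where w = "\<lambda>\<omega>. \<bar>B t \<omega> - B s \<omega>\<bar>"])
      show "AE \<omega> in P. (\<lambda>m. \<Phi> k \<omega> * trunc (real m) (B t \<omega> - B s \<omega>)) \<longlonglongrightarrow> \<Phi> k \<omega> * (B t \<omega> - B s \<omega>)"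
        by (intro AE_I2 tendsto_mult tendsto_const tendsto_eventually trunc_eventually_id)
      show "AE \<omega> in P. norm (\<Phi> k \<omega> * trunc (real m) (B t \<omega> - B s \<omega>)) \<le> \<bar>B t \<omega> - B s \<omega>\<bar>" for m
        using order_trans[OF \<Phi>_abs abs_trunc_le_arg] by simp
    qed (use int in auto)
    have "(\<lambda>m. \<integral>\<omega>. \<Phi> k \<omega> * trunc (real m) (B t \<omega> - B s \<omega>) \<partial>P) \<longlonglongrightarrow> 0"
    proof (rule tendsto_rabs_zero_cancel, rule tendsto_sandwich[OF _ _ tendsto_const])
      show "eventually (\<lambda>m. 0 \<le> \<bar>\<integral>\<omega>. \<Phi> k \<omega> * trunc (real m) (B t \<omega> - B s \<omega>) \<partial>P\<bar>) sequentially"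
        by simp
      show "eventually (\<lambda>m. \<bar>\<integral>\<omega>. \<Phi> k \<omega> * trunc (real m) (B t \<omega> - B s \<omega>) \<partial>P\<bar>
          \<le> (t - s) * (2 * G 1) / real m) sequentially"
        using truncated_increment_small[OF J(2,3) st] unfolding \<Phi>_def
        by (auto intro: eventually_mono[OF eventually_gt_at_top[of 0]])
      show "(\<lambda>m. (t - s) * (2 * G 1) / real m) \<longlonglongrightarrow> 0" by (rule lim_const_over_n)
    qed
    then show ?thesis using lim LIMSEQ_unique by blast
  qed
  have "(\<lambda>k. \<integral>\<omega>. \<Phi> k \<omega> * (B t \<omega> - B s \<omega>) \<partial>P) \<longlonglongrightarrow> (\<integral>\<omega>. indicator A \<omega> * (B t \<omega> - B s \<omega>) \<partial>P)"
  proof (rule integral_dominated_convergence[where w = "\<lambda>\<omega>. \<bar>B t \<omega> - B s \<omega>\<bar>"])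
    have "A \<in> sets P"
      using A sets_past_subset[of s] sets_P unfolding sets_past_boxes by (auto intro: sigma_sets.Basic)
    then show "(\<lambda>\<omega>. indicator A \<omega> * (B t \<omega> - B s \<omega>)) \<in> borel_measurable P" by measurable
    show "AE \<omega> in P. (\<lambda>k. \<Phi> k \<omega> * (B t \<omega> - B s \<omega>)) \<longlonglongrightarrow> indicator A \<omega> * (B t \<omega> - B s \<omega>)"
    proof (intro AE_I2 tendsto_mult tendsto_const)
      fix \<omega> assume "\<omega> \<in> space P"
      then have "indicator A \<omega> = (\<Prod>j\<in>J. of_bool (snd j < B (fst j) \<omega>) :: real)"
      proof (cases "\<forall>j\<in>J. snd j < B (fst j) \<omega>")
        case True
        then have "\<omega> \<in> A" using \<open>\<omega> \<in> space P\<close> by (auto simp: J(1) space_P)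
        then show ?thesis using True by (simp add: prod.neutral)
      next
        case False
        then have "\<omega> \<notin> A" by (auto simp: J(1))
        then show ?thesis using False J(2) by (auto intro!: prod_zero[symmetric])
      qed
      moreover have "(\<lambda>k. \<Phi> k \<omega>) \<longlonglongrightarrow> (\<Prod>j\<in>J. of_bool (snd j < B (fst j) \<omega>))"
        unfolding \<Phi>_def case_prod_beta by (intro tendsto_prod ramp_tendsto)
      ultimately show "(\<lambda>k. \<Phi> k \<omega>) \<longlonglongrightarrow> indicator A \<omega>" by simp
    qed
    show "AE \<omega> in P. norm (\<Phi> k \<omega> * (B t \<omega> - B s \<omega>)) \<le> \<bar>B t \<omega> - B s \<omega>\<bar>" for k
      using \<Phi>_abs by simp
  qed (use int in auto)
  then show ?thesis unfolding zero by (simp add: LIMSEQ_const_iff)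
qed

text \<open>Boxes generate the past and are stable under intersection, and the sets with the
  asserted property form a Dynkin system.\<close>

lemma past_fair:
  assumes st: "0 \<le> s" "s \<le> t" and A: "A \<in> sets (past s)"
  shows "(\<integral>\<omega>. indicator A \<omega> * (B t \<omega> - B s \<omega>) \<partial>P) = 0"
proof (cases "s = t")
  case False
  then have lt: "s < t" using st by simp
  have int: "integrable P (\<lambda>\<omega>. B t \<omega> - B s \<omega>)" using integrable_B st by simp
  have subP: "sigma_sets paths (past_boxes s) \<subseteq> sets P"
    using sets_past_subset[of s] sets_P unfolding sets_past_boxes by simp
  have boxes: "past_boxes s \<subseteq> Pow paths" by (auto simp: past_boxes_def)
  have full: "paths \<in> past_boxes s"
    unfolding past_boxes_def by (intro CollectI exI[of _ "{}"]) auto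
  from Int_stable_past_boxes boxes A[unfolded sets_past_boxes] show ?thesis
  proof (induction rule: sigma_sets_induct_disjoint)
    case (basic A)
    then show ?case by (rule past_box_fair[OF st(1) lt])
  next
    case empty
    show ?case by simp
  next
    case (compl A)
    then have A: "A \<in> sets P" using subP by blast
    have "(\<integral>\<omega>. indicator (paths - A) \<omega> * (B t \<omega> - B s \<omega>) \<partial>P)
      = (\<integral>\<omega>. indicator paths \<omega> * (B t \<omega> - B s \<omega>) - indicator A \<omega> * (B t \<omega> - B s \<omega>) \<partial>P)"
      using sets.sets_into_space[OF A] 
      by (intro Bochner_Integration.integral_cong) (auto simp: indicator_def space_P)
    also have "\<dots> = (\<integral>\<omega>. indicator paths \<omega> * (B t \<omega> - B s \<omega>) \<partial>P) - (\<integral>\<omega>. indicator A \<omega> * (B t \<omega> - B s \<omega>) \<partial>P)"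
      using integrable_real_mult_indicator[OF A int] integrable_real_mult_indicator[OF sets.top int]
      by (intro Bochner_Integration.integral_diff) (simp_all add: mult.commute space_P)
    finally show ?case using compl past_box_fair[OF st(1) lt full] by simp
  next
    case (union A)
    then have A: "\<And>i. A i \<in> sets P" using subP by blast
    have "set_integrable P (\<Union>i. A i) (\<lambda>\<omega>. B t \<omega> - B s \<omega>)"
      unfolding set_integrable_def using A int by (intro integrable_mult_indicator) auto
    then have "(LINT \<omega>:(\<Union>i. A i)|P. B t \<omega> - B s \<omega>) = (\<Sum>i. LINT \<omega>:A i|P. B t \<omega> - B s \<omega>)"
      using union(1) A by (intro lebesgue_integral_countable_add) (auto simp: disjoint_family_on_def)
    then show ?case using union(3) by (simp add: set_lebesgue_integral_def)
  qed
qed simp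

end

context G_brownian_law
begin

lemma continuous_martingale_B: "continuous_martingale P past B"
proof
  fix s t :: real
  show "subalgebra P (past t)"
    using sets_past_subset[of t] by (simp add: subalgebra_def space_past space_P sets_P)
  show "0 \<le> s \<Longrightarrow> s \<le> t \<Longrightarrow> B s \<in> borel_measurable (past t)"
    by (rule B_measurable_past)
  show "0 \<le> t \<Longrightarrow> integrable P (B t)" by (rule integrable_B)
  show "0 \<le> s \<Longrightarrow> s \<le> t \<Longrightarrow> A \<in> sets (past s) \<Longrightarrow>
      (\<integral>\<omega>. indicator A \<omega> * (B t \<omega> - B s \<omega>) \<partial>P) = 0" for A
    by (rule past_fair)
  show "\<omega> \<in> space P \<Longrightarrow> continuous_on {0..} (\<lambda>t. B t \<omega>)" for \<omega>
    by (simp add: space_P paths_def B_def[abs_def])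
qed

lemma escape_set_null:
  fixes a c :: real
  assumes "0 \<le> p" "p < q"
  defines "S \<equiv> {\<omega> \<in> paths. escapes (\<lambda>t. c * (B t \<omega> - a)) p q}"
  shows "S \<in> sets path_algebra" and "S \<in> null_sets P"
proof -
  interpret X: continuous_martingale P past "\<lambda>t \<omega>. c * (B t \<omega> - a)"
    by (rule continuous_martingale.affine[OF continuous_martingale_B])
  have S: "S \<in> sets P"
    using X.escapes_measurable[OF assms(1,2)] unfolding S_def pred_def space_P .
  then show "S \<in> sets path_algebra" by (simp add: sets_P)
  have "AE \<omega> in P. \<omega> \<notin> S"
    using X.AE_not_escapes[OF assms(1,2)] by eventually_elim (simp add: S_def)
  with S show "S \<in> null_sets P" by (simp add: AE_iff_null_sets)
qed

end

section \<open>The exceptional set\<close>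

definition escape_set :: "real \<Rightarrow> (real \<Rightarrow> real) set" where
  "escape_set a = (\<Union>(p, q, c) \<in> {(p, q, c). p \<in> \<rat> \<and> q \<in> \<rat> \<and> 0 \<le> p \<and> p < q \<and> c \<in> {1, - 1}}.
     {\<omega> \<in> paths. escapes (\<lambda>t. c * (B t \<omega> - a)) p q})"

lemma countable_escape_indices:
  "countable {(p, q, c :: real). p \<in> \<rat> \<and> q \<in> \<rat> \<and> 0 \<le> p \<and> p < q \<and> c \<in> {1, - 1}}"
  (is "countable ?I")
proof (rule countable_subset)
  show "?I \<subseteq> \<rat> \<times> \<rat> \<times> {1, - 1}" by auto
qed (intro countable_SIGMA countable_rat, simp)

text \<open>A neighbourhood that isolates \<open>t\<close> contains rationals \<open>p \<le> t < q\<close>, and the sign \<open>c\<close> is that of the path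
  at \<open>q\<close> relative to the level.  The point \<open>t = 0\<close> is its own \<open>p\<close>.\<close>

lemma isolated_level_in_escape_set:
  assumes \<omega>: "\<omega> \<in> paths" and t: "0 \<le> t" "t isolated_in level_set a \<omega>"
  shows "\<omega> \<in> escape_set a"
proof -
  obtain U where U: "open U" "U \<inter> level_set a \<omega> = {t}" and ta: "t \<in> level_set a \<omega>"
    using t(2) unfolding isolated_in_def by blast
  then obtain e where e: "0 < e" "\<And>s. \<bar>s - t\<bar> < e \<Longrightarrow> s \<in> U"
    unfolding open_real_def[symmetric] by (metis (no_types) IntD1 dist_real_def insertI1 open_dist)
  have only: "B s \<omega> \<noteq> a" if "0 \<le> s" "\<bar>s - t\<bar> < e" "s \<noteq> t" for s
    using U(2) e(2)[OF that(2)] that by (auto simp: level_set_def)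
  obtain p where p: "p \<in> \<rat>" "0 \<le> p" "p \<le> t" "t - e < p"
  proof (cases "t = 0")
    case True
    then show ?thesis using that[of 0] e(1) by simp
  next
    case False
    then have "max 0 (t - e) < t" using t(1) e(1) by simp
    then obtain p where "p \<in> \<rat>" "max 0 (t - e) < p" "p < t" using Rats_dense_in_real by blast
    then show ?thesis using that[of p] by simp
  qed
  obtain q where q: "q \<in> \<rat>" "t < q" "q < t + e" using Rats_dense_in_real[of t "t + e"] e(1) by auto
  define c :: real where "c = (if B q \<omega> > a then 1 else - 1)"
  let ?f = "\<lambda>t. c * (B t \<omega> - a)"
  have "escapes ?f p q"
  proof (rule isolated_zero_escapes[of _ _ _ t])
    have "continuous_on {p..q} \<omega>"
      using \<omega> p(2) unfolding paths_def by (auto intro: continuous_on_subset)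
    then show "continuous_on {p..q} ?f" unfolding B_def by (intro continuous_intros)
    show "?f t = 0" using ta by (simp add: level_set_def)
    show "?f s \<noteq> 0" if "s \<in> {p..q}" "s \<noteq> t" for s
    proof -
      have "0 \<le> s" "\<bar>s - t\<bar> < e" using that p q by (auto simp: abs_less_iff)
      then show ?thesis using only[of s] that(2) by (simp add: c_def)
    qed
    show "0 < ?f q" using only[of q] p q by (auto simp: c_def)
  qed (use p q in auto)
  moreover have "c \<in> {1, - 1}" by (simp add: c_def)
  ultimately show ?thesis
    unfolding escape_set_def using \<omega> p q by (intro UN_I[of "(p, q, c)"]) auto
qed

theorem theorem5p1:
  fixes H :: "('w \<Rightarrow> real) set"
    and E :: "('w \<Rightarrow> real) \<Rightarrow> real"
    and G :: "real \<Rightarrow> real"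
    and \<xi> :: "nat \<Rightarrow> 'w \<Rightarrow> real"
    and Ehat :: "((real \<Rightarrow> real) \<Rightarrow> real) \<Rightarrow> real"
    and \<P> :: "(real \<Rightarrow> real) measure set"
    and a :: real
  assumes "sublinear_expectation_space H E"
    and "monotone_sublinear G"
    and "\<And>i. G_normal H E G (\<xi> i)"
    and "\<And>i j. eq_in_dist E (\<xi> i) (\<xi> j)"
    and "\<And>i. indep_from E (\<xi> (Suc i)) (map \<xi> [0..<Suc i])"
    and "G_expectation_on_L_ip E \<xi> Ehat"
    and "represents \<P> Ehat"
    and "- Ehat (\<lambda>\<omega>. - (B 1 \<omega>)\<^sup>2) > 0"
  shows "quasi_surely \<P> (\<lambda>\<omega>. \<not> (\<exists>t\<in>{0..}. t isolated_in level_set a \<omega>))"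
proof -
  have law: "G_brownian_law H E G \<xi> Ehat \<P> P" if "P \<in> \<P>" for P
    using assms(1,3,5,6,7) that by (simp add: G_brownian_law_def G_brownian_law_axioms_def)
  have nonempty: "\<P> \<noteq> {}" using assms(7) by (simp add: represents_def)
  have "escape_set a \<in> sets path_algebra"
  proof -
    obtain P where "P \<in> \<P>" using nonempty by blast
    then interpret G_brownian_law H E G \<xi> Ehat \<P> P by (rule law)
    show ?thesis
      unfolding escape_set_def
      using escape_set_null(1) by (intro sets.countable_UN'' countable_escape_indices) auto
  qed
  moreover have "capacity \<P> (escape_set a) = 0"
  proof -
    have "measure P (escape_set a) = 0" if "P \<in> \<P>" for P
    proof -
      interpret G_brownian_law H E G \<xi> Ehat \<P> P using that by (rule law)
      have "escape_set a \<in> null_sets P"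
        unfolding escape_set_def
        using escape_set_null(2) by (intro null_sets_UN' countable_escape_indices) auto
      then show ?thesis by (simp add: measure_eq_0_null_sets)
    qed
    then show ?thesis unfolding capacity_def using nonempty by simp
  qed
  ultimately have "polar \<P> (escape_set a)" by (simp add: polar_def)
  then show ?thesis
    unfolding quasi_surely_def using isolated_level_in_escape_set by auto
qed

end
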